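(* Let $L\in C^1([a,b]\times\mathbb{R}^{2N};\mathbb{R})$ and $\mathbf{y}^a,\mathbf{y}^b\in\mathbb{R}^N$. Let $\mathbf{y}=(y_1,\ldots,y_N)$ be a local minimizer of $$\mathcal{J}(\mathbf{y})=\int_a^b L[\mathbf{y}]^{\alpha,\beta}_{\gamma}(x)\,dx$$ over all $\mathbf{y}\in\mathbf{D}$ satisfying the boundary conditions $\mathbf{y}(a)=\mathbf{y}^a$, $\mathbf{y}(b)=\mathbf{y}^b$. Then $\mathbf{y}$ satisfies the following system of $N$ fractional Euler--Lagrange equations: $$\partial_i L[\mathbf{y}]^{\alpha,\beta}_{\gamma}(x)+D^{\beta_{i-1},\alpha_{i-1}}_{1-\gamma_{i-1}}\,\partial_{N+i}L[\mathbf{y}]^{\alpha,\beta}_{\gamma}(x)=0,\qquad i=2,\ldots,N+1,$$ for all $x\in[a,b]$.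
   Context: Let $a<b$, $N\in\mathbb{N}$, and $\alpha,\beta,\gamma\in\mathbb{R}^N$ with $\alpha_i,\beta_i\in(0,1)$, $\gamma_i\in[0,1]$. For scalar $\alpha\in(0,1)$, the left and right Riemann--Liouville fractional integrals are ${}_aI_x^{\alpha}f(x)=\frac{1}{\Gamma(\alpha)}\int_a^x(x-t)^{\alpha-1}f(t)\,dt$ and ${}_xI_b^{\alpha}f(x)=\frac{1}{\Gamma(\alpha)}\int_x^b(t-x)^{\alpha-1}f(t)\,dt$. The left and right Riemann--Liouville derivatives are ${}_aD_x^{\alpha}f=\frac{d}{dx}\,{}_aI_x^{1-\alpha}f$ and ${}_xD_b^{\alpha}f=-\frac{d}{dx}\,{}_xI_b^{1-\alpha}f$. For $f\in AC([a,b])$ (absolutely continuous), the left and right Caputo derivatives are ${}^C_aD_x^{\alpha}f={}_aI_x^{1-\alpha}f'$ and ${}^C_xD_b^{\alpha}f=-\,{}_xI_b^{1-\alpha}f'$. For scalars $\alpha,\beta\in(0,1)$, $\gamma\in[0,1]$: the combined Caputo derivative is ${}^CD^{\alpha,\beta}_{\gamma}=\gamma\,{}^C_aD_x^{\alpha}+(1-\gamma)\,{}^C_xD_b^{\beta}$, and $D^{\beta,\alpha}_{1-\gamma}=(1-\gamma)\,{}_aD_x^{\beta}+\gamma\,{}_xD_b^{\alpha}$. For vector parameters and $\mathbf{y}=(y_1,\ldots,y_N)$, ${}^CD^{\alpha,\beta}_{\gamma}\mathbf{y}=[{}^CD^{\alpha_1,\beta_1}_{\gamma_1}y_1,\ldots,{}^CD^{\alpha_N,\beta_N}_{\gamma_N}y_N]$.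 $\mathbf{D}$ is the set of $\mathbf{y}:[a,b]\to\mathbb{R}^N$ with components in $AC([a,b])$ such that ${}^CD^{\alpha,\beta}_{\gamma}\mathbf{y}$ exists and is continuous on $[a,b]$, with norm $\|\mathbf{y}\|_{1,\infty}=\max_{[a,b]}\|\mathbf{y}(x)\|+\max_{[a,b]}\|{}^CD^{\alpha,\beta}_{\gamma}\mathbf{y}(x)\|$, where $\|\cdot\|$ is a norm on $\mathbb{R}^N$. $[\mathbf{y}]^{\alpha,\beta}_{\gamma}(x)=(x,\mathbf{y}(x),{}^CD^{\alpha,\beta}_{\gamma}\mathbf{y}(x))$, and $L[\mathbf{y}]^{\alpha,\beta}_{\gamma}(x)$ is $L$ evaluated at this point. $\partial_iK$ is the partial derivative of $K$ with respect to its $i$th argument (so for $i=2,\ldots,N+1$, $\partial_iL$ is with respect to the $(i-1)$th component of $\mathbf{y}$ and $\partial_{N+i}L$ with respect to the $(i-1)$th component of the fractional derivative). A local minimizer of $\mathcal{J}$ on an admissible set $\mathcal{D}\subset\mathbf{D}$ is $\bar{\mathbf{y}}\in\mathcal{D}$ for which there is $\delta>0$ with $\mathcal{J}(\bar{\mathbf{y}})\le\mathcal{J}(\mathbf{y})$ for all $\mathbf{y}\in\mathcal{D}$ with $\|\mathbf{y}-\bar{\mathbf{y}}\|_{1,\infty}<\delta$.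
   Formalization: The two Riemann–Liouville derivatives in D^{β,α}_{1-γ} need not exist separately; the equation is proved for all x in [a,b] with d/dx taken of the combined fractional integral, and termwise at each x where the terms with nonzero coefficient exist. *)

theory Defs
  imports "HOL-Analysis.Analysis"
begin

definition absolutely_continuous_on_Icc :: "real \<Rightarrow> real \<Rightarrow> (real \<Rightarrow> real) \<Rightarrow> bool" where
  "absolutely_continuous_on_Icc a b f \<longleftrightarrow>
     (\<forall>\<epsilon>>0. \<exists>\<delta>>0. \<forall>(n::nat) u v.
        (\<forall>k<n. a \<le> u k \<and> u k \<le> v k \<and> v k \<le> b) \<longrightarrow>
        disjoint_family_on (\<lambda>k. {u k<..<v k}) {..<n} \<longrightarrow>
        (\<Sum>k<n. v k - u k) < \<delta> \<longrightarrow>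
        (\<Sum>k<n. \<bar>f (v k) - f (u k)\<bar>) < \<epsilon>)"

text \<open>All integrals are Lebesgue integrals. The Lebesgue integral of HOL-Analysis is total, so
  existence of the fractional integrals at a point is recorded separately.\<close>

definition left_RL_integral :: "real \<Rightarrow> real \<Rightarrow> (real \<Rightarrow> real) \<Rightarrow> real \<Rightarrow> real" where
  "left_RL_integral a \<alpha> f x =
     1 / Gamma \<alpha> * (LINT t:{a..x}|lebesgue. (x - t) powr (\<alpha> - 1) * f t)"

definition right_RL_integral :: "real \<Rightarrow> real \<Rightarrow> (real \<Rightarrow> real) \<Rightarrow> real \<Rightarrow> real" where
  "right_RL_integral b \<alpha> f x =
     1 / Gamma \<alpha> * (LINT t:{x..b}|lebesgue. (t - x) powr (\<alpha> - 1) * f t)"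

definition left_RL_integral_exists :: "real \<Rightarrow> real \<Rightarrow> (real \<Rightarrow> real) \<Rightarrow> real \<Rightarrow> bool" where
  "left_RL_integral_exists a \<alpha> f x \<longleftrightarrow>
     (\<lambda>t. (x - t) powr (\<alpha> - 1) * f t) absolutely_integrable_on {a..x}"

definition right_RL_integral_exists :: "real \<Rightarrow> real \<Rightarrow> (real \<Rightarrow> real) \<Rightarrow> real \<Rightarrow> bool" where
  "right_RL_integral_exists b \<alpha> f x \<longleftrightarrow>
     (\<lambda>t. (t - x) powr (\<alpha> - 1) * f t) absolutely_integrable_on {x..b}"

text \<open>Derivatives of functions on \<open>[a, b]\<close> are taken within \<open>[a, b]\<close>, hence one-sided at the end points.\<close>

definition left_RL_deriv :: "real \<Rightarrow> real \<Rightarrow> real \<Rightarrow> (real \<Rightarrow> real) \<Rightarrow> real \<Rightarrow> real" where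
  "left_RL_deriv a b \<alpha> f x =
     vector_derivative (left_RL_integral a (1 - \<alpha>) f) (at x within {a..b})"

definition right_RL_deriv :: "real \<Rightarrow> real \<Rightarrow> real \<Rightarrow> (real \<Rightarrow> real) \<Rightarrow> real \<Rightarrow> real" where
  "right_RL_deriv a b \<alpha> f x =
     - vector_derivative (right_RL_integral b (1 - \<alpha>) f) (at x within {a..b})"

definition left_RL_differentiable :: "real \<Rightarrow> real \<Rightarrow> real \<Rightarrow> (real \<Rightarrow> real) \<Rightarrow> real \<Rightarrow> bool" where
  "left_RL_differentiable a b \<alpha> f x \<longleftrightarrow>
     left_RL_integral a (1 - \<alpha>) f differentiable (at x within {a..b})"

definition right_RL_differentiable :: "real \<Rightarrow> real \<Rightarrow> real \<Rightarrow> (real \<Rightarrow> real) \<Rightarrow> real \<Rightarrow> bool" where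
  "right_RL_differentiable a b \<alpha> f x \<longleftrightarrow>
     right_RL_integral b (1 - \<alpha>) f differentiable (at x within {a..b})"

text \<open>Absolutely continuous functions are differentiable only almost everywhere; the value of
  \<^term>\<open>deriv f\<close> on the exceptional null set does not affect the integrals below.\<close>

definition left_Caputo_deriv :: "real \<Rightarrow> real \<Rightarrow> (real \<Rightarrow> real) \<Rightarrow> real \<Rightarrow> real" where
  "left_Caputo_deriv a \<alpha> f x = left_RL_integral a (1 - \<alpha>) (deriv f) x"

definition right_Caputo_deriv :: "real \<Rightarrow> real \<Rightarrow> (real \<Rightarrow> real) \<Rightarrow> real \<Rightarrow> real" where
  "right_Caputo_deriv b \<alpha> f x = - right_RL_integral b (1 - \<alpha>) (deriv f) x"

definition combined_Caputo_deriv ::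
  "real \<Rightarrow> real \<Rightarrow> real \<Rightarrow> real \<Rightarrow> real \<Rightarrow> (real \<Rightarrow> real) \<Rightarrow> real \<Rightarrow> real" where
  "combined_Caputo_deriv a b \<alpha> \<beta> \<gamma> f x =
     \<gamma> * left_Caputo_deriv a \<alpha> f x + (1 - \<gamma>) * right_Caputo_deriv b \<beta> f x"

text \<open>A term whose coefficient is zero is regarded as absent and need not exist; for instance,
  for \<open>\<gamma> = 1\<close> the combined derivative is just the left one.\<close>

definition combined_Caputo_exists ::
  "real \<Rightarrow> real \<Rightarrow> real \<Rightarrow> real \<Rightarrow> real \<Rightarrow> (real \<Rightarrow> real) \<Rightarrow> real \<Rightarrow> bool" where
  "combined_Caputo_exists a b \<alpha> \<beta> \<gamma> f x \<longleftrightarrow>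
     (\<gamma> \<noteq> 0 \<longrightarrow> left_RL_integral_exists a (1 - \<alpha>) (deriv f) x) \<and>
     (1 - \<gamma> \<noteq> 0 \<longrightarrow> right_RL_integral_exists b (1 - \<beta>) (deriv f) x)"

text \<open>Here \<open>D\<^sup>\<alpha>\<^sup>,\<^sup>\<beta>\<close> with weight \<open>\<gamma>\<close> puts \<open>\<gamma>\<close> on the left derivative of order \<open>\<alpha>\<close> and \<open>1 - \<gamma>\<close> on the
  right derivative of order \<open>\<beta>\<close>.\<close>

definition combined_RL_deriv ::
  "real \<Rightarrow> real \<Rightarrow> real \<Rightarrow> real \<Rightarrow> real \<Rightarrow> (real \<Rightarrow> real) \<Rightarrow> real \<Rightarrow> real" where
  "combined_RL_deriv a b \<alpha> \<beta> \<gamma> f x =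
     \<gamma> * left_RL_deriv a b \<alpha> f x + (1 - \<gamma>) * right_RL_deriv a b \<beta> f x"

definition combined_RL_exists ::
  "real \<Rightarrow> real \<Rightarrow> real \<Rightarrow> real \<Rightarrow> real \<Rightarrow> (real \<Rightarrow> real) \<Rightarrow> real \<Rightarrow> bool" where
  "combined_RL_exists a b \<alpha> \<beta> \<gamma> f x \<longleftrightarrow>
     (\<gamma> \<noteq> 0 \<longrightarrow> left_RL_differentiable a b \<alpha> f x) \<and>
     (1 - \<gamma> \<noteq> 0 \<longrightarrow> right_RL_differentiable a b \<beta> f x)"

text \<open>The function whose derivative is the combined Riemann--Liouville derivative. It may be
  differentiable at points where neither of its two terms is: on \<open>[0, 1]\<close> with \<open>\<alpha> = \<beta>\<close> and
  \<open>\<gamma> = 1/2\<close>, the function \<open>f t = (t * (1 - t)) powr (\<alpha>/2)\<close> has an affine combined integral, whereas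
  its left and right Riemann--Liouville derivatives are infinite at \<open>0\<close> and \<open>1\<close> respectively.\<close>

definition combined_RL_integral ::
  "real \<Rightarrow> real \<Rightarrow> real \<Rightarrow> real \<Rightarrow> real \<Rightarrow> (real \<Rightarrow> real) \<Rightarrow> real \<Rightarrow> real" where
  "combined_RL_integral a b \<alpha> \<beta> \<gamma> f x =
     \<gamma> * left_RL_integral a (1 - \<alpha>) f x - (1 - \<gamma>) * right_RL_integral b (1 - \<beta>) f x"

lemma combined_RL_integral_has_derivative:
  assumes "combined_RL_exists a b \<alpha> \<beta> \<gamma> f x"
  shows "(combined_RL_integral a b \<alpha> \<beta> \<gamma> f has_real_derivative
            combined_RL_deriv a b \<alpha> \<beta> \<gamma> f x) (at x within {a..b})"
proof -
  have l: "((\<lambda>x. \<gamma> * left_RL_integral a (1 - \<alpha>) f x) has_real_derivative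
             \<gamma> * left_RL_deriv a b \<alpha> f x) (at x within {a..b})"
  proof (cases "\<gamma> = 0")
    case False
    then have "(left_RL_integral a (1 - \<alpha>) f has_real_derivative left_RL_deriv a b \<alpha> f x)
        (at x within {a..b})"
      using assms
      by (simp add: combined_RL_exists_def left_RL_differentiable_def left_RL_deriv_def
          vector_derivative_works has_real_derivative_iff_has_vector_derivative)
    then show ?thesis by (rule DERIV_cmult)
  qed simp
  have r: "((\<lambda>x. (1 - \<gamma>) * right_RL_integral b (1 - \<beta>) f x) has_real_derivative
             (1 - \<gamma>) * (- right_RL_deriv a b \<beta> f x)) (at x within {a..b})"
  proof (cases "1 - \<gamma> = 0")
    case False
    then have "(right_RL_integral b (1 - \<beta>) f has_real_derivative - right_RL_deriv a b \<beta> f x)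
        (at x within {a..b})"
      using assms
      by (simp add: combined_RL_exists_def right_RL_differentiable_def right_RL_deriv_def
          vector_derivative_works has_real_derivative_iff_has_vector_derivative)
    then show ?thesis by (rule DERIV_cmult)
  qed simp
  show ?thesis
    using DERIV_diff[OF l r]
    by (simp add: combined_RL_integral_def[abs_def] combined_RL_deriv_def)
qed

definition combined_Caputo_vec ::
  "real \<Rightarrow> real \<Rightarrow> real^'n \<Rightarrow> real^'n \<Rightarrow> real^'n \<Rightarrow> (real \<Rightarrow> real^'n) \<Rightarrow> real \<Rightarrow> real^'n" where
  "combined_Caputo_vec a b \<alpha> \<beta> \<gamma> y x =
     (\<chi> i. combined_Caputo_deriv a b (\<alpha> $ i) (\<beta> $ i) (\<gamma> $ i) (\<lambda>t. y t $ i) x)"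

text \<open>Curves are functions on all of \<open>\<real>\<close>, but only their values on \<open>[a, b]\<close> are relevant.\<close>

definition curve_space ::
  "real \<Rightarrow> real \<Rightarrow> real^'n \<Rightarrow> real^'n \<Rightarrow> real^'n \<Rightarrow> (real \<Rightarrow> real^'n) set" where
  "curve_space a b \<alpha> \<beta> \<gamma> =
     {y. (\<forall>i. absolutely_continuous_on_Icc a b (\<lambda>t. y t $ i)) \<and>
         (\<forall>i. \<forall>x\<in>{a..b}.
            combined_Caputo_exists a b (\<alpha> $ i) (\<beta> $ i) (\<gamma> $ i) (\<lambda>t. y t $ i) x) \<and>
         continuous_on {a..b} (combined_Caputo_vec a b \<alpha> \<beta> \<gamma> y)}"

definition is_norm :: "('v::real_vector \<Rightarrow> real) \<Rightarrow> bool" where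
  "is_norm \<nu> \<longleftrightarrow>
     (\<forall>u. \<nu> u \<ge> 0) \<and> (\<forall>u. \<nu> u = 0 \<longleftrightarrow> u = 0) \<and>
     (\<forall>c u. \<nu> (c *\<^sub>R u) = \<bar>c\<bar> * \<nu> u) \<and> (\<forall>u v. \<nu> (u + v) \<le> \<nu> u + \<nu> v)"

definition norm_1_inf ::
  "(real^'n \<Rightarrow> real) \<Rightarrow> real \<Rightarrow> real \<Rightarrow> real^'n \<Rightarrow> real^'n \<Rightarrow> real^'n \<Rightarrow> (real \<Rightarrow> real^'n) \<Rightarrow> real" where
  "norm_1_inf \<nu> a b \<alpha> \<beta> \<gamma> y =
     (SUP x\<in>{a..b}. \<nu> (y x)) + (SUP x\<in>{a..b}. \<nu> (combined_Caputo_vec a b \<alpha> \<beta> \<gamma> y x))"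

definition jet ::
  "real \<Rightarrow> real \<Rightarrow> real^'n \<Rightarrow> real^'n \<Rightarrow> real^'n \<Rightarrow> (real \<Rightarrow> real^'n) \<Rightarrow> real \<Rightarrow>
     real \<times> (real^'n) \<times> (real^'n)" where
  "jet a b \<alpha> \<beta> \<gamma> y x = (x, y x, combined_Caputo_vec a b \<alpha> \<beta> \<gamma> y x)"

definition action ::
  "real \<Rightarrow> real \<Rightarrow> real^'n \<Rightarrow> real^'n \<Rightarrow> real^'n \<Rightarrow> (real \<times> (real^'n) \<times> (real^'n) \<Rightarrow> real) \<Rightarrow>
     (real \<Rightarrow> real^'n) \<Rightarrow> real" where
  "action a b \<alpha> \<beta> \<gamma> L y = (LINT x:{a..b}|lebesgue. L (jet a b \<alpha> \<beta> \<gamma> y x))"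

definition admissible_curves ::
  "real \<Rightarrow> real \<Rightarrow> real^'n \<Rightarrow> real^'n \<Rightarrow> real^'n \<Rightarrow> real^'n \<Rightarrow> real^'n \<Rightarrow> (real \<Rightarrow> real^'n) set" where
  "admissible_curves a b \<alpha> \<beta> \<gamma> ya yb = {y \<in> curve_space a b \<alpha> \<beta> \<gamma>. y a = ya \<and> y b = yb}"

definition local_minimizer ::
  "((real \<Rightarrow> 'v::real_vector) \<Rightarrow> real) \<Rightarrow> (real \<Rightarrow> 'v) set \<Rightarrow> ((real \<Rightarrow> 'v) \<Rightarrow> real) \<Rightarrow>
     (real \<Rightarrow> 'v) \<Rightarrow> bool" where
  "local_minimizer \<nu> A J y \<longleftrightarrow>
     y \<in> A \<and> (\<exists>\<delta>>0. \<forall>z\<in>A. \<nu> (\<lambda>x. z x - y x) < \<delta> \<longrightarrow> J y \<le> J z)"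

definition C1_on :: "'v::real_normed_vector set \<Rightarrow> ('v \<Rightarrow> real) \<Rightarrow> bool" where
  "C1_on S f \<longleftrightarrow>
     (\<exists>f' :: 'v \<Rightarrow> 'v \<Rightarrow>\<^sub>L real.
        (\<forall>z\<in>S. (f has_derivative blinfun_apply (f' z)) (at z within S)) \<and> continuous_on S f')"

text \<open>Partial derivatives of \<open>L (x, u, v)\<close> in the \<open>i\<close>-th component of \<open>u\<close> and of \<open>v\<close>.\<close>

definition partial_u ::
  "'n \<Rightarrow> (real \<times> (real^'n) \<times> (real^'n) \<Rightarrow> real) \<Rightarrow> real \<times> (real^'n) \<times> (real^'n) \<Rightarrow> real" where
  "partial_u i L = (\<lambda>(x, u, v). deriv (\<lambda>s. L (x, u + s *\<^sub>R axis i 1, v)) 0)"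

definition partial_v ::
  "'n \<Rightarrow> (real \<times> (real^'n) \<times> (real^'n) \<Rightarrow> real) \<Rightarrow> real \<times> (real^'n) \<times> (real^'n) \<Rightarrow> real" where
  "partial_v i L = (\<lambda>(x, u, v). deriv (\<lambda>s. L (x, u, v + s *\<^sub>R axis i 1)) 0)"

end

theory Submission
  imports Defs
begin

text \<open>Vary the \<open>i\<close>-th component of the minimizer by \<open>\<epsilon> \<eta>\<close> with \<open>\<eta>\<close> continuously differentiable and
  vanishing at the end points. The combined Caputo derivative is a convolution \<open>k * y'\<close> with an
  integrable kernel, so the first variation reads \<open>\<integral> g \<eta> + \<phi> (k * \<eta>') = 0\<close> with \<open>g = \<partial>\<^sub>uL\<close> and \<open>\<phi> = \<partial>\<^sub>vL\<close>.
  By Fubini and integration by parts this is \<open>\<integral> \<eta>' (G + k\<^sup>- * \<phi>) = 0\<close>, where \<open>G' = - g\<close> and \<open>k\<^sup>- s = k (- s)\<close>.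
  As \<open>\<eta>'\<close> is an arbitrary continuous function of mean zero, the bracket is constant, hence
  \<open>- k\<^sup>- * \<phi>\<close>, which is the combined Riemann--Liouville integral of \<open>\<phi>\<close>, has derivative \<open>- g\<close>.

  That the Caputo derivative is additive along \<open>y + \<epsilon> \<eta>\<close> needs \<open>y\<close> to be differentiable almost
  everywhere. The bad points are those where, for some slopes \<open>p < q\<close>, a difference quotient is
  infinitely often below \<open>p\<close> and infinitely often above \<open>q\<close>, or where it is unbounded. On a neighbourhood \<open>U\<close>
  of a compact set \<open>K\<close> of such points the increments of \<open>y\<close> are then at most \<open>p\<close> and at least \<open>q\<close>
  times the length, up to the variation of \<open>y\<close> over the small set \<open>U - K\<close>, so \<open>K\<close> is null. The
  one-sided comparison replaces the usual appeal to the Vitali covering theorem.\<close>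

section \<open>Almost everywhere differentiability of absolutely continuous functions\<close>

text \<open>The last point of \<open>[s, t]\<close> at which \<open>f - W\<close> does not exceed its value at \<open>s\<close> exists because \<open>f\<close> is
  continuous and \<open>W\<close> can only jump upwards; by \<open>step\<close> it must be \<open>t\<close>.\<close>

lemma growth_right:
  fixes f W :: "real \<Rightarrow> real"
  assumes st: "s \<le> t" and f: "continuous_on {s..t} f" and W: "mono_on {s..t} W"
    and step: "\<And>x. s \<le> x \<Longrightarrow> x < t \<Longrightarrow> \<exists>v. x < v \<and> v \<le> t \<and> f v - W v \<le> f x - W x"
  shows "f t - f s \<le> W t - W s"
proof -
  define A where "A = {x\<in>{s..t}. f x - W x \<le> f s - W s}"
  define m where "m = Sup A"
  have sA: "s \<in> A" using st by (simp add: A_def)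
  have bdd: "bdd_above A" by (rule bdd_aboveI[of _ t]) (auto simp: A_def)
  have m1: "s \<le> m" unfolding m_def by (rule cSup_upper[OF sA bdd])
  have m2: "m \<le> t" unfolding m_def by (rule cSup_least) (use sA in \<open>auto simp: A_def\<close>)
  have up: "x \<le> m" if "x \<in> A" for x unfolding m_def by (rule cSup_upper[OF that bdd])
  \<comment> \<open>\<open>A\<close> itself need not be closed, since \<open>W\<close> may jump.
    Replacing \<open>W x\<close> by the larger \<open>W m\<close> gives a closed superset, whose
    condition at the point \<open>m\<close> is that of \<open>A\<close>.\<close>
  have sub: "A \<subseteq> {x\<in>{s..t}. f x \<le> f s - W s + W m}"
  proof
    fix x assume x: "x \<in> A"
    then have "W x \<le> W m" using m1 m2 up[OF x] by (intro mono_onD[OF W]) (auto simp: A_def)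
    then show "x \<in> {x\<in>{s..t}. f x \<le> f s - W s + W m}" using x by (auto simp: A_def)
  qed
  have "closed {x\<in>{s..t}. f x \<le> f s - W s + W m}"
    by (intro continuous_on_closed_Collect_le f continuous_on_const closed_atLeastAtMost)
  moreover have "m \<in> closure A" unfolding m_def using sA bdd by (intro closure_contains_Sup) auto
  ultimately have mA: "m \<in> A" using closure_minimal[OF sub] m1 m2 by (auto simp: A_def)
  have "m = t"
  proof (rule ccontr)
    assume "m \<noteq> t"
    then obtain v where v: "m < v" "v \<le> t" "f v - W v \<le> f m - W m" using step[of m] m1 m2 by auto
    then have "v \<in> A" using mA m1 by (auto simp: A_def)
    then show False using up v by fastforce
  qed
  then show ?thesis using mA by (simp add: A_def)
qed

text \<open>The point reflection sending \<open>f\<close> to \<open>- f (- x)\<close> preserves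
  increments and monotonicity and turns steps to the left into steps to the right, so
  \<open>growth_right\<close> applies.\<close>

lemma growth_left:
  fixes f W :: "real \<Rightarrow> real"
  assumes st: "s \<le> t" and f: "continuous_on {s..t} f" and W: "mono_on {s..t} W"
    and step: "\<And>x. s < x \<Longrightarrow> x \<le> t \<Longrightarrow> \<exists>u. s \<le> u \<and> u < x \<and> f x - W x \<le> f u - W u"
  shows "f t - f s \<le> W t - W s"
proof -
  have "(\<lambda>x. - f (- x)) (- s) - (\<lambda>x. - f (- x)) (- t) \<le> (\<lambda>x. - W (- x)) (- s) - (\<lambda>x. - W (- x)) (- t)"
  proof (rule growth_right[where f = "\<lambda>x. - f (- x)" and W = "\<lambda>x. - W (- x)" and s = "- t" and t = "- s"])
    show "continuous_on {- t..- s} (\<lambda>x. - f (- x))"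
      by (intro continuous_intros continuous_on_compose2[OF f]) auto
    show "mono_on {- t..- s} (\<lambda>x. - W (- x))"
      by (rule mono_onI) (auto intro: mono_onD[OF W])
    fix x assume "- t \<le> x" "x < - s"
    then obtain u where "s \<le> u \<and> u < - x \<and> f (- x) - W (- x) \<le> f u - W u"
      using step[of "- x"] by auto
    then show "\<exists>v. x < v \<and> v \<le> - s \<and> - f (- v) - - W (- v) \<le> - f (- x) - - W (- x)"
      by (intro exI[of _ "- u"]) auto
  qed (use st in auto)
  then show ?thesis by simp
qed

section \<open>Variation of absolutely continuous functions over small sets\<close>

lemma AC_obtains_modulus:
  assumes "absolutely_continuous_on_Icc a b f" "e > 0"
  obtains d where "d > 0"
    "\<And>(n::nat) u v. (\<And>k. k < n \<Longrightarrow> a \<le> u k \<and> u k \<le> v k \<and> v k \<le> b) \<Longrightarrow>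
        disjoint_family_on (\<lambda>k. {u k<..<v k}) {..<n} \<Longrightarrow>
        (\<Sum>k<n. v k - u k) < d \<Longrightarrow> (\<Sum>k<n. \<bar>f (v k) - f (u k)\<bar>) < e"
proof -
  have "\<exists>d>0. \<forall>(n::nat) u v. (\<forall>k<n. a \<le> u k \<and> u k \<le> v k \<and> v k \<le> b) \<longrightarrow>
        disjoint_family_on (\<lambda>k. {u k<..<v k}) {..<n} \<longrightarrow>
        (\<Sum>k<n. v k - u k) < d \<longrightarrow> (\<Sum>k<n. \<bar>f (v k) - f (u k)\<bar>) < e"
    by (rule assms(1)[unfolded absolutely_continuous_on_Icc_def, rule_format, OF assms(2)])
  then obtain d where d: "d > 0" and D: "\<forall>(n::nat) u v. (\<forall>k<n. a \<le> u k \<and> u k \<le> v k \<and> v k \<le> b) \<longrightarrow>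
        disjoint_family_on (\<lambda>k. {u k<..<v k}) {..<n} \<longrightarrow>
        (\<Sum>k<n. v k - u k) < d \<longrightarrow> (\<Sum>k<n. \<bar>f (v k) - f (u k)\<bar>) < e"
    by (elim exE conjE)
  show ?thesis
  proof (rule that[OF d])
    fix n :: nat and u v :: "nat \<Rightarrow> real"
    assume "\<And>k. k < n \<Longrightarrow> a \<le> u k \<and> u k \<le> v k \<and> v k \<le> b"
      "disjoint_family_on (\<lambda>k. {u k<..<v k}) {..<n}" "(\<Sum>k<n. v k - u k) < d"
    then show "(\<Sum>k<n. \<bar>f (v k) - f (u k)\<bar>) < e" by (intro D[rule_format]) simp_all
  qed
qed

lemma AC_imp_continuous_on:
  assumes "absolutely_continuous_on_Icc a b f"
  shows "continuous_on {a..b} f"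
  unfolding continuous_on_iff
proof (intro ballI allI impI)
  fix x e :: real assume x: "x \<in> {a..b}" and e: "0 < e"
  obtain d where d: "d > 0" and D: "\<And>(n::nat) u v. (\<And>k. k < n \<Longrightarrow> a \<le> u k \<and> u k \<le> v k \<and> v k \<le> b) \<Longrightarrow>
        disjoint_family_on (\<lambda>k. {u k<..<v k}) {..<n} \<Longrightarrow>
        (\<Sum>k<n. v k - u k) < d \<Longrightarrow> (\<Sum>k<n. \<bar>f (v k) - f (u k)\<bar>) < e"
    by (rule AC_obtains_modulus[OF assms e]) blast
  show "\<exists>d>0. \<forall>x'\<in>{a..b}. dist x' x < d \<longrightarrow> dist (f x') (f x) < e"
  proof (intro exI[of _ d] conjI d ballI impI)
    fix x' assume x': "x' \<in> {a..b}" "dist x' x < d"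
    have "(\<Sum>k<Suc 0. \<bar>f (max x x') - f (min x x')\<bar>) < e"
      by (rule D[of "Suc 0" "\<lambda>_. min x x'" "\<lambda>_. max x x'"])
        (use x x' in \<open>auto simp: disjoint_family_on_def dist_real_def\<close>)
    then show "dist (f x') (f x) < e" by (cases "x \<le> x'") (auto simp: dist_real_def)
  qed
qed

text \<open>The function \<open>W\<close> is the variation of \<open>f\<close> over \<open>V \<inter> [a, x]\<close>.\<close>

lemma AC_variation_on_small_set:
  assumes f: "absolutely_continuous_on_Icc a b f" and ab: "a \<le> b" and e: "e > 0"
  obtains d where "d > 0"
    "\<And>V. V \<in> lmeasurable \<Longrightarrow> measure lebesgue V < d \<Longrightarrow>
       \<exists>W. mono_on {a..b} W \<and> W b - W a \<le> e \<and>
         (\<forall>u v. a \<le> u \<longrightarrow> u \<le> v \<longrightarrow> v \<le> b \<longrightarrow> {u<..<v} \<subseteq> V \<longrightarrow> \<bar>f v - f u\<bar> \<le> W v - W u)"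
proof -
  obtain d where d: "d > 0" and D: "\<And>(n::nat) u v. (\<And>k. k < n \<Longrightarrow> a \<le> u k \<and> u k \<le> v k \<and> v k \<le> b) \<Longrightarrow>
        disjoint_family_on (\<lambda>k. {u k<..<v k}) {..<n} \<Longrightarrow>
        (\<Sum>k<n. v k - u k) < d \<Longrightarrow> (\<Sum>k<n. \<bar>f (v k) - f (u k)\<bar>) < e"
    by (rule AC_obtains_modulus[OF f e]) blast
  have "\<exists>W. mono_on {a..b} W \<and> W b - W a \<le> e \<and>
         (\<forall>u v. a \<le> u \<longrightarrow> u \<le> v \<longrightarrow> v \<le> b \<longrightarrow> {u<..<v} \<subseteq> V \<longrightarrow> \<bar>f v - f u\<bar> \<le> W v - W u)"
    if V: "V \<in> lmeasurable" "measure lebesgue V < d" for V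
  proof -
    define F where "F x n u v \<longleftrightarrow> (\<forall>k<n. a \<le> u k \<and> u k \<le> v k \<and> v k \<le> x \<and> {u k<..<v k} \<subseteq> V) \<and>
       disjoint_family_on (\<lambda>k. {u k<..<v k}) {..<n}" for x and n :: nat and u v
    define S where "S x = {\<Sum>k<n. \<bar>f (v k) - f (u k)\<bar> |n u v. F x n u v}" for x
    \<comment> \<open>The disjoint intervals of a family lie in \<open>V\<close>, so their total
      length is below \<open>d\<close> and the modulus of absolute continuity bounds the sum,
      uniformly in the family.\<close>
    have le: "(\<Sum>k<n. \<bar>f (v k) - f (u k)\<bar>) \<le> e" if "F x n u v" "x \<le> b" for x n u v
    proof -
      have "(\<Sum>k<n. v k - u k) = (\<Sum>k<n. measure lebesgue {u k<..<v k})"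
        using that by (intro sum.cong) (auto simp: F_def)
      also have "\<dots> = measure lebesgue (\<Union>k<n. {u k<..<v k})"
        using that by (intro measure_finite_Union[symmetric]) (auto simp: F_def)
      also have "\<dots> \<le> measure lebesgue V"
        using that V by (intro measure_mono_fmeasurable) (auto simp: F_def)
      finally have "(\<Sum>k<n. v k - u k) < d" using V by simp
      then show ?thesis using that by (intro less_imp_le D) (auto simp: F_def dest: order_trans)
    qed
    have bdd: "bdd_above (S x)" if "x \<le> b" for x
      by (rule bdd_aboveI[of _ e]) (use le that in \<open>auto simp: S_def\<close>)
    have zero: "0 \<in> S x" for x
      unfolding S_def by (intro CollectI exI[of _ 0]) (auto simp: F_def disjoint_family_on_def)
    have main: "\<bar>f v - f u\<bar> \<le> Sup (S v) - Sup (S u)"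
      if uv: "a \<le> u" "u \<le> v" "v \<le> b" "{u<..<v} \<subseteq> V" for u v
    proof -
      \<comment> \<open>Appending the interval from \<open>u\<close> to \<open>v\<close> to any
        family that ends by \<open>u\<close> gives a family for \<open>v\<close>, so the supremum
        grows by at least the increment of \<open>f\<close>.\<close>
      have "Sup (S u) \<le> Sup (S v) - \<bar>f v - f u\<bar>"
      proof (rule cSup_least)
        fix z assume "z \<in> S u"
        then obtain n p q where z: "z = (\<Sum>k<n. \<bar>f (q k) - f (p k)\<bar>)" and F: "F u n p q"
          by (auto simp: S_def)
        have 1: "(\<Sum>k<Suc n. \<bar>f ((q(n := v)) k) - f ((p(n := u)) k)\<bar>) = z + \<bar>f v - f u\<bar>"
          by (simp add: z)
        have dis: "disjoint_family_on (\<lambda>k. {(p(n := u)) k<..<(q(n := v)) k}) {..<Suc n}"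
          using F unfolding disjoint_family_on_def F_def
          by (auto simp: less_Suc_eq)
        have "F v (Suc n) (p(n := u)) (q(n := v))"
          unfolding F_def
        proof (intro conjI dis allI impI)
          fix k assume "k < Suc n"
          then show "a \<le> (p(n := u)) k" "(p(n := u)) k \<le> (q(n := v)) k" "(q(n := v)) k \<le> v"
            "{(p(n := u)) k<..<(q(n := v)) k} \<subseteq> V"
            using F uv unfolding F_def by (auto simp: less_Suc_eq intro: order_trans)
        qed
        then have "z + \<bar>f v - f u\<bar> \<in> S v" unfolding S_def 1[symmetric] by blast
        then show "z \<le> Sup (S v) - \<bar>f v - f u\<bar>" using cSup_upper[OF _ bdd[OF uv(3)]] by fastforce
      qed (use zero in blast)
      then show ?thesis by simp
    qed
    show ?thesis
    proof (intro exI[of _ "\<lambda>x. Sup (S x)"] conjI allI impI main)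
      show "mono_on {a..b} (\<lambda>x. Sup (S x))"
      proof (rule mono_onI)
        fix x y assume xy: "x \<in> {a..b}" "y \<in> {a..b}" "x \<le> y"
        have "S x \<subseteq> S y" unfolding S_def F_def using xy(3) by (blast intro: order_trans)
        then show "Sup (S x) \<le> Sup (S y)" using zero xy by (intro cSup_subset_mono bdd) auto
      qed
      have "Sup (S b) \<le> e" by (rule cSup_least) (use zero[of b] le in \<open>auto simp: S_def\<close>)
      moreover have "0 \<le> Sup (S a)" by (rule cSup_upper[OF zero bdd[OF ab]])
      ultimately show "Sup (S b) - Sup (S a) \<le> e" by simp
    qed auto
  qed
  with d show ?thesis using that by blast
qed

section \<open>Falling points and comparison with monotone functions\<close>

text \<open>\<open>r\<close> selects the side. Either way \<open>f\<close> strictly decreases over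
  arbitrarily short intervals with end point \<open>x\<close>, the kind of step that
  \<open>growth_right\<close> and \<open>growth_left\<close> use. For \<open>f v - p * v\<close> it
  says that difference quotients of \<open>f\<close> on that side are frequently below
  \<open>p\<close>.\<close>

definition falls :: "bool \<Rightarrow> (real \<Rightarrow> real) \<Rightarrow> real \<Rightarrow> bool" where
  "falls r f x \<longleftrightarrow>
     (if r then \<exists>\<^sub>F v in at_right x. f v < f x else \<exists>\<^sub>F u in at_left x. f x < f u)"

text \<open>At points of \<open>K\<close> a step with decreasing \<open>f\<close> is available, so only the variation over \<open>U - K\<close> counts.\<close>

lemma falls_imp_increment_le:
  assumes f: "continuous_on {a..b} f" and K: "\<And>x. x \<in> K \<Longrightarrow> falls r f x"
    and V: "open (U - K)" and W: "mono_on {a..b} W"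
    and fW: "\<And>u v. a \<le> u \<Longrightarrow> u \<le> v \<Longrightarrow> v \<le> b \<Longrightarrow> {u<..<v} \<subseteq> U - K \<Longrightarrow> \<bar>f v - f u\<bar> \<le> W v - W u"
    and st: "a \<le> s" "s \<le> t" "t \<le> b" "{s..t} \<subseteq> U"
  shows "f t - f s \<le> W t - W s"
proof -
  have f': "continuous_on {s..t} f" and W': "mono_on {s..t} W"
    using st by (auto intro: continuous_on_subset[OF f] mono_on_subset[OF W])
  show ?thesis
  proof (cases r)
    case True
    show ?thesis
    proof (rule growth_right[OF st(2) f' W'])
      fix x assume x: "s \<le> x" "x < t"
      show "\<exists>v. x < v \<and> v \<le> t \<and> f v - W v \<le> f x - W x"
      proof (cases "x \<in> K")
        case True
        then have "\<exists>\<^sub>F v in at_right x. f v < f x" using K \<open>r\<close> by (auto simp: falls_def)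
        moreover have "\<forall>\<^sub>F v in at_right x. v \<in> {x<..<t}"
          by (rule eventually_at_right_real[OF x(2)])
        ultimately have "\<exists>\<^sub>F v in at_right x. f v < f x \<and> v \<in> {x<..<t}"
          by (rule frequently_rev_mp[OF _ eventually_mono]) auto
        then obtain v where v: "f v < f x" "x < v" "v < t" by (auto dest: frequently_ex)
        then have "W x \<le> W v" using x st by (intro mono_onD[OF W]) auto
        then show ?thesis using v by (intro exI[of _ v]) auto
      next
        case False
        then have "x \<in> U - K" using x st by auto
        then obtain e where e: "e > 0" "ball x e \<subseteq> U - K" using V open_contains_ball by metis
        \<comment> \<open>Off \<open>K\<close> a whole interval to the right of \<open>x\<close>
          lies in \<open>U - K\<close>, where \<open>W\<close> dominates the increments of
          \<open>f\<close>; the minimum keeps \<open>v\<close> inside \<open>[s, t]\<close>.\<close>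
        define v where "v = min t (x + e)"
        have "{x<..<v} \<subseteq> ball x e" by (auto simp: v_def dist_real_def)
        then have "\<bar>f v - f x\<bar> \<le> W v - W x"
          using e x st by (intro fW) (auto simp: v_def)
        then show ?thesis using x e by (intro exI[of _ v]) (auto simp: v_def)
      qed
    qed
  next
    case False
    show ?thesis
    proof (rule growth_left[OF st(2) f' W'])
      fix x assume x: "s < x" "x \<le> t"
      show "\<exists>u. s \<le> u \<and> u < x \<and> f x - W x \<le> f u - W u"
      proof (cases "x \<in> K")
        case True
        then have "\<exists>\<^sub>F v in at_left x. f x < f v" using K \<open>\<not> r\<close> by (auto simp: falls_def)
        moreover have "\<forall>\<^sub>F v in at_left x. v \<in> {s<..<x}"
          by (rule eventually_at_left_real[OF x(1)])
        ultimately have "\<exists>\<^sub>F v in at_left x. f x < f v \<and> v \<in> {s<..<x}"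
          by (rule frequently_rev_mp[OF _ eventually_mono]) auto
        then obtain v where v: "f x < f v" "s < v" "v < x" by (auto dest: frequently_ex)
        then have "W v \<le> W x" using x st by (intro mono_onD[OF W]) auto
        then show ?thesis using v by (intro exI[of _ v]) auto
      next
        case False
        then have "x \<in> U - K" using x st by auto
        then obtain e where e: "e > 0" "ball x e \<subseteq> U - K" using V open_contains_ball by metis
        define v where "v = max s (x - e)"
        have "{v<..<x} \<subseteq> ball x e" by (auto simp: v_def dist_real_def)
        then have "\<bar>f x - f v\<bar> \<le> W x - W v"
          using e x st by (intro fW) (auto simp: v_def)
        then show ?thesis using x e by (intro exI[of _ v]) (auto simp: v_def)
      qed
    qed
  qed
qed

text \<open>\<open>growth_right\<close> compares \<open>W\<close> with \<open>c\<close> times the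
  measure of \<open>K\<close> up to \<open>x\<close>. Near a point of \<open>K\<close>,
  \<open>W\<close> grows at rate at least \<open>c\<close> and the measure term at rate at most
  \<open>c\<close>; off \<open>K\<close> the measure term is locally constant and \<open>W\<close>
  is monotone.\<close>

lemma measure_compact_le_increment:
  fixes W :: "real \<Rightarrow> real"
  assumes K: "compact K" "K \<subseteq> U" and U: "open U" "U \<subseteq> {a<..<b}" and ab: "a \<le> b" and c: "c \<ge> 0"
    and W: "mono_on {a..b} W"
    and cW: "\<And>s t. a \<le> s \<Longrightarrow> s \<le> t \<Longrightarrow> t \<le> b \<Longrightarrow> {s..t} \<subseteq> U \<Longrightarrow> c * (t - s) \<le> W t - W s"
  shows "c * measure lebesgue K \<le> W b - W a"
proof -
  have mK: "K \<in> lmeasurable" using K lmeasurable_compact by blast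
  have int: "K \<inter> {a..x} \<in> lmeasurable" for x using mK by (intro fmeasurable_Int_fmeasurable) auto
  define h where "h x = c * measure lebesgue (K \<inter> {a..x})" for x
  have h1: "h v - h x \<le> c * (v - x)" and h2: "h x \<le> h v" if "x \<le> v" for x v
  proof -
    have "measure lebesgue (K \<inter> {a..v}) \<le> measure lebesgue (K \<inter> {a..x} \<union> {x..v})"
      using int by (intro measure_mono_fmeasurable) auto
    also have "\<dots> \<le> measure lebesgue (K \<inter> {a..x}) + measure lebesgue {x..v}"
      using int by (intro measure_Un_le) auto
    finally show "h v - h x \<le> c * (v - x)"
      using that c unfolding h_def right_diff_distrib[symmetric] by (intro mult_left_mono) auto
    have "measure lebesgue (K \<inter> {a..x}) \<le> measure lebesgue (K \<inter> {a..v})"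
      using int that by (intro measure_mono_fmeasurable) auto
    then show "h x \<le> h v" using c by (simp add: h_def mult_left_mono)
  qed
  have lip: "\<bar>h v - h x\<bar> \<le> c * \<bar>v - x\<bar>" for v x
    using h1[of x v] h2[of x v] h1[of v x] h2[of v x] by (cases "x \<le> v") auto
  have "c-lipschitz_on {a..b} h"
    using lip c by (intro lipschitz_onI) (auto simp: dist_real_def)
  then have cont: "continuous_on {a..b} h" by (rule lipschitz_on_continuous_on)
  have "h b - h a \<le> W b - W a"
  proof (rule growth_right[OF ab cont W])
    fix x assume x: "a \<le> x" "x < b"
    show "\<exists>v. x < v \<and> v \<le> b \<and> h v - W v \<le> h x - W x"
    proof (cases "x \<in> K")
      case True
      then have "x \<in> U" using K by auto
      then obtain e where e: "e > 0" "cball x e \<subseteq> U" using U open_contains_cball by metis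
      define v where "v = min b (x + e)"
      have "{x..v} \<subseteq> cball x e" by (auto simp: v_def dist_real_def)
      then have "c * (v - x) \<le> W v - W x" using x e by (intro cW) (auto simp: v_def)
      then show ?thesis using x e h1[of x v] by (intro exI[of _ v]) (auto simp: v_def)
    next
      case False
      have "open (- K)" using K compact_imp_closed by blast
      then obtain e where e: "e > 0" "cball x e \<subseteq> - K" using False open_contains_cball by (metis ComplI)
      define v where "v = min b (x + e)"
      have v: "x < v" "v \<le> b" using e x by (auto simp: v_def)
      have "{x..v} \<subseteq> cball x e" by (auto simp: v_def dist_real_def)
      then have "{x..v} \<inter> K = {}" using e by auto
      then have "y \<in> {a..v} \<longleftrightarrow> y \<in> {a..x}" if "y \<in> K" for y
      proof -
        have "y \<notin> {x..v}" using \<open>{x..v} \<inter> K = {}\<close> that by blast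
        then show ?thesis using v by auto
      qed
      then have "K \<inter> {a..v} = K \<inter> {a..x}" by blast
      then have "h v = h x" by (simp add: h_def)
      moreover have "W x \<le> W v" using v x by (intro mono_onD[OF W]) auto
      ultimately show ?thesis using v by (intro exI[of _ v]) auto
    qed
  qed
  \<comment> \<open>\<open>U\<close> omits the end points, so the comparison starts at
    \<open>h a = 0\<close>.\<close>
  moreover have "K \<inter> {a..a} = {}" "K \<inter> {a..b} = K" using K U by fastforce+
  ultimately show ?thesis by (simp add: h_def)
qed

section \<open>Closure properties of absolutely continuous functions\<close>

lemma AC_add:
  assumes f: "absolutely_continuous_on_Icc a b f" and g: "absolutely_continuous_on_Icc a b g"
  shows "absolutely_continuous_on_Icc a b (\<lambda>x. f x + g x)"
  unfolding absolutely_continuous_on_Icc_def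
proof (intro allI impI)
  fix e :: real assume "e > 0"
  then have e: "e / 2 > 0" by simp
  obtain d1 where d1: "d1 > 0" and D1: "\<And>(n::nat) u v. (\<And>k. k < n \<Longrightarrow> a \<le> u k \<and> u k \<le> v k \<and> v k \<le> b) \<Longrightarrow>
        disjoint_family_on (\<lambda>k. {u k<..<v k}) {..<n} \<Longrightarrow>
        (\<Sum>k<n. v k - u k) < d1 \<Longrightarrow> (\<Sum>k<n. \<bar>f (v k) - f (u k)\<bar>) < e / 2"
    by (rule AC_obtains_modulus[OF f e]) blast
  obtain d2 where d2: "d2 > 0" and D2: "\<And>(n::nat) u v. (\<And>k. k < n \<Longrightarrow> a \<le> u k \<and> u k \<le> v k \<and> v k \<le> b) \<Longrightarrow>
        disjoint_family_on (\<lambda>k. {u k<..<v k}) {..<n} \<Longrightarrow>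
        (\<Sum>k<n. v k - u k) < d2 \<Longrightarrow> (\<Sum>k<n. \<bar>g (v k) - g (u k)\<bar>) < e / 2"
    by (rule AC_obtains_modulus[OF g e]) blast
  show "\<exists>\<delta>>0. \<forall>(n::nat) u v.
        (\<forall>k<n. a \<le> u k \<and> u k \<le> v k \<and> v k \<le> b) \<longrightarrow>
        disjoint_family_on (\<lambda>k. {u k<..<v k}) {..<n} \<longrightarrow>
        (\<Sum>k<n. v k - u k) < \<delta> \<longrightarrow>
        (\<Sum>k<n. \<bar>f (v k) + g (v k) - (f (u k) + g (u k))\<bar>) < e"
  proof (intro exI[of _ "min d1 d2"] conjI allI impI)
    fix n :: nat and u v :: "nat \<Rightarrow> real"
    assume A: "\<forall>k<n. a \<le> u k \<and> u k \<le> v k \<and> v k \<le> b"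
      "disjoint_family_on (\<lambda>k. {u k<..<v k}) {..<n}" "(\<Sum>k<n. v k - u k) < min d1 d2"
    have "(\<Sum>k<n. \<bar>f (v k) + g (v k) - (f (u k) + g (u k))\<bar>)
        \<le> (\<Sum>k<n. \<bar>f (v k) - f (u k)\<bar> + \<bar>g (v k) - g (u k)\<bar>)"
      by (intro sum_mono) linarith
    also have "\<dots> = (\<Sum>k<n. \<bar>f (v k) - f (u k)\<bar>) + (\<Sum>k<n. \<bar>g (v k) - g (u k)\<bar>)"
      by (rule sum.distrib)
    also have "\<dots> < e / 2 + e / 2"
      using A by (intro add_strict_mono D1 D2) auto
    finally show "(\<Sum>k<n. \<bar>f (v k) + g (v k) - (f (u k) + g (u k))\<bar>) < e" by simp
  qed (use d1 d2 in auto)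
qed

lemma AC_uminus:
  assumes "absolutely_continuous_on_Icc a b f"
  shows "absolutely_continuous_on_Icc a b (\<lambda>x. - f x)"
proof -
  have "\<bar>- f x - - f y\<bar> = \<bar>f x - f y\<bar>" for x y by simp
  then show ?thesis using assms by (simp only: absolutely_continuous_on_Icc_def)
qed

lemma AC_lipschitz:
  assumes "C-lipschitz_on {a..b} f"
  shows "absolutely_continuous_on_Icc a b f"
  unfolding absolutely_continuous_on_Icc_def
proof (intro allI impI)
  fix e :: real assume e: "e > 0"
  have C: "C \<ge> 0" using assms lipschitz_on_nonneg by blast
  show "\<exists>\<delta>>0. \<forall>(n::nat) u v.
        (\<forall>k<n. a \<le> u k \<and> u k \<le> v k \<and> v k \<le> b) \<longrightarrow>
        disjoint_family_on (\<lambda>k. {u k<..<v k}) {..<n} \<longrightarrow>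
        (\<Sum>k<n. v k - u k) < \<delta> \<longrightarrow> (\<Sum>k<n. \<bar>f (v k) - f (u k)\<bar>) < e"
  \<comment> \<open>The added 1 keeps the denominator positive when \<open>C = 0\<close>.\<close>
  proof (intro exI[of _ "e / (C + 1)"] conjI allI impI)
    fix n :: nat and u v :: "nat \<Rightarrow> real"
    assume A: "\<forall>k<n. a \<le> u k \<and> u k \<le> v k \<and> v k \<le> b" "(\<Sum>k<n. v k - u k) < e / (C + 1)"
    have "(\<Sum>k<n. \<bar>f (v k) - f (u k)\<bar>) \<le> (\<Sum>k<n. (C + 1) * (v k - u k))"
    proof (rule sum_mono)
      fix k assume "k \<in> {..<n}"
      then have k: "a \<le> u k" "u k \<le> v k" "v k \<le> b" using A by auto
      then have "\<bar>f (v k) - f (u k)\<bar> \<le> C * (v k - u k)"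
        using lipschitz_onD[OF assms, of "v k" "u k"] by (simp add: dist_real_def)
      also have "\<dots> \<le> (C + 1) * (v k - u k)" using k by (intro mult_right_mono) auto
      finally show "\<bar>f (v k) - f (u k)\<bar> \<le> (C + 1) * (v k - u k)" .
    qed
    also have "\<dots> = (C + 1) * (\<Sum>k<n. v k - u k)" by (rule sum_distrib_left[symmetric])
    also have "\<dots> < e" using A C by (simp add: field_simps)
    finally show "(\<Sum>k<n. \<bar>f (v k) - f (u k)\<bar>) < e" .
  qed (use e C in auto)
qed

lemma AC_linear: "absolutely_continuous_on_Icc a b (\<lambda>x. p * x)"
  by (rule AC_lipschitz[of "\<bar>p\<bar>"])
    (auto intro!: lipschitz_onI simp: dist_real_def abs_mult right_diff_distrib[symmetric])

section \<open>Null sets of falling points\<close>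

text \<open>Outer regularity makes the excess over \<open>K\<close> small; intersecting with the
  interval and with \<open>G\<close> only shrinks it, and removing the closed set \<open>K\<close>
  leaves it open.\<close>

lemma small_outer_open:
  fixes a b :: real
  assumes K: "compact K" "K \<subseteq> {a<..<b}" and G: "open G" "K \<subseteq> G" and d: "d > 0"
  obtains U where "open U" "K \<subseteq> U" "U \<subseteq> {a<..<b}" "U \<subseteq> G" "open (U - K)" "U - K \<in> lmeasurable"
    "measure lebesgue (U - K) < d"
proof -
  have "K \<in> sets lebesgue" using K lmeasurable_compact by blast
  then obtain T where T: "open T" "K \<subseteq> T" "T - K \<in> lmeasurable" "emeasure lebesgue (T - K) < ennreal d"
    using sets_lebesgue_outer_open d by metis
  define U where "U = T \<inter> {a<..<b} \<inter> G"
  have U: "open U" "K \<subseteq> U" using T K G by (auto simp: U_def intro!: open_Int)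
  have o: "open (U - K)" using U K by (simp add: open_Diff compact_imp_closed)
  have "U - K \<in> lmeasurable"
  proof (rule fmeasurableI2[OF T(3)])
    show "U - K \<in> sets lebesgue" using o by auto
  qed (auto simp: U_def)
  moreover have "measure lebesgue (U - K) \<le> measure lebesgue (T - K)"
    using T o by (intro measure_mono_fmeasurable) (auto simp: U_def)
  moreover have "measure lebesgue (T - K) < d"
    using T d by (simp add: emeasure_eq_measure2 ennreal_less_iff)
  ultimately show ?thesis using that[of U] U o by (auto simp: U_def)
qed

text \<open>\<open>d\<close> is fixed before \<open>U\<close>, so that several functions can be
  bounded on one common neighbourhood of \<open>K\<close>.\<close>

lemma falls_on_compact_bound:
  assumes f: "absolutely_continuous_on_Icc a b f" and ab: "a \<le> b" and e: "e > 0"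
    and K: "\<And>x. x \<in> K \<Longrightarrow> falls r f x"
  obtains d where "d > 0"
    "\<And>U. open (U - K) \<Longrightarrow> U - K \<in> lmeasurable \<Longrightarrow> measure lebesgue (U - K) < d \<Longrightarrow>
       \<exists>W. mono_on {a..b} W \<and> W b - W a \<le> e \<and>
         (\<forall>s t. a \<le> s \<longrightarrow> s \<le> t \<longrightarrow> t \<le> b \<longrightarrow> {s..t} \<subseteq> U \<longrightarrow> f t - f s \<le> W t - W s)"
proof -
  obtain d where d: "d > 0" and D: "\<And>V. V \<in> lmeasurable \<Longrightarrow> measure lebesgue V < d \<Longrightarrow>
       \<exists>W. mono_on {a..b} W \<and> W b - W a \<le> e \<and>
         (\<forall>u v. a \<le> u \<longrightarrow> u \<le> v \<longrightarrow> v \<le> b \<longrightarrow> {u<..<v} \<subseteq> V \<longrightarrow> \<bar>f v - f u\<bar> \<le> W v - W u)"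
    by (rule AC_variation_on_small_set[OF f ab e]) blast
  show ?thesis
  proof (rule that[OF d])
    fix U assume U: "open (U - K)" "U - K \<in> lmeasurable" "measure lebesgue (U - K) < d"
    then obtain W where W: "mono_on {a..b} W" "W b - W a \<le> e" and
      fW: "\<And>u v. a \<le> u \<Longrightarrow> u \<le> v \<Longrightarrow> v \<le> b \<Longrightarrow> {u<..<v} \<subseteq> U - K \<Longrightarrow> \<bar>f v - f u\<bar> \<le> W v - W u"
      using D[of "U - K"] by blast
    have "f t - f s \<le> W t - W s" if "a \<le> s" "s \<le> t" "t \<le> b" "{s..t} \<subseteq> U" for s t
      by (rule falls_imp_increment_le[OF AC_imp_continuous_on[OF f] K U(1) W(1) fW that])
    then show "\<exists>W. mono_on {a..b} W \<and> W b - W a \<le> e \<and>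
         (\<forall>s t. a \<le> s \<longrightarrow> s \<le> t \<longrightarrow> t \<le> b \<longrightarrow> {s..t} \<subseteq> U \<longrightarrow> f t - f s \<le> W t - W s)"
      using W by blast
  qed
qed

text \<open>Inner regularity: a bounded measurable set exceeds some compact subset by measure less
  than \<open>e\<close>, and compact subsets have measure zero by assumption.\<close>

lemma negligible_if_compact_subsets:
  fixes E :: "real set"
  assumes E: "E \<in> sets lebesgue" and K: "\<And>K. compact K \<Longrightarrow> K \<subseteq> E \<Longrightarrow> measure lebesgue K \<le> 0"
    and bE: "bounded E"
  shows "negligible E"
proof (subst negligible_outer_le, intro allI impI)
  fix e :: real assume e: "e > 0"
  obtain T where T: "closed T" "T \<subseteq> E" "E - T \<in> lmeasurable" "emeasure lebesgue (E - T) < ennreal e"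
    using sets_lebesgue_inner_closed[OF E e] by metis
  have cT: "compact T" using T bounded_subset[OF bE T(2)] by (simp add: compact_eq_bounded_closed)
  then have mT: "T \<in> lmeasurable" by (rule lmeasurable_compact)
  have "measure lebesgue E \<le> measure lebesgue (E - T) + measure lebesgue T"
    using measure_Un_le[of "E - T" lebesgue T] T mT by (simp add: Un_absorb2 fmeasurableD)
  also have "\<dots> \<le> e + 0"
    using K[OF cT T(2)] T e by (intro add_mono) (auto simp: emeasure_eq_measure2 ennreal_less_iff)
  finally have "measure lebesgue E \<le> e" by simp
  moreover have "E \<in> lmeasurable" using bE E by (rule bounded_set_imp_lmeasurable)
  ultimately show "\<exists>T. E \<subseteq> T \<and> T \<in> lmeasurable \<and> measure lebesgue T \<le> e" by blast
qed

text \<open>Around a compact part \<open>K\<close> of \<open>E\<close> the increments of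
  \<open>f\<close> and \<open>g\<close> are bounded by those of monotone functions whose total
  growth is at most \<open>e\<close>, whereas together they amount to \<open>c\<close> times the
  length. The application has \<open>c = q - p\<close>, for difference quotients that are frequently
  below \<open>p\<close> and frequently above \<open>q\<close>.\<close>

lemma negligible_both_fall:
  assumes ab: "a \<le> b" and f: "absolutely_continuous_on_Icc a b f"
    and g: "absolutely_continuous_on_Icc a b g"
    and c: "c > 0" and fg: "\<And>x. f x + g x = c * x"
    and E: "E \<in> sets lebesgue" "E \<subseteq> {a<..<b}"
    and Ef: "\<And>x. x \<in> E \<Longrightarrow> falls r f x" and Eg: "\<And>x. x \<in> E \<Longrightarrow> falls r' g x"
  shows "negligible E"
proof (rule negligible_if_compact_subsets[OF E(1)])
  show "bounded E" by (rule bounded_subset[OF bounded_closed_interval[of a b]]) (use E(2) in force)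
  fix K assume K: "compact K" "K \<subseteq> E"
  have "c * measure lebesgue K \<le> 0 + e" if "e > 0" for e
  proof -
    have e: "e / 2 > 0" using that by simp
    obtain d1 where d1: "d1 > 0" and
      D1: "\<And>U. open (U - K) \<Longrightarrow> U - K \<in> lmeasurable \<Longrightarrow> measure lebesgue (U - K) < d1 \<Longrightarrow>
       \<exists>W. mono_on {a..b} W \<and> W b - W a \<le> e / 2 \<and>
         (\<forall>s t. a \<le> s \<longrightarrow> s \<le> t \<longrightarrow> t \<le> b \<longrightarrow> {s..t} \<subseteq> U \<longrightarrow> f t - f s \<le> W t - W s)"
      by (rule falls_on_compact_bound[OF f ab e, of K r]) (use K Ef in blast)+
    obtain d2 where d2: "d2 > 0" and
      D2: "\<And>U. open (U - K) \<Longrightarrow> U - K \<in> lmeasurable \<Longrightarrow> measure lebesgue (U - K) < d2 \<Longrightarrow>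
       \<exists>W. mono_on {a..b} W \<and> W b - W a \<le> e / 2 \<and>
         (\<forall>s t. a \<le> s \<longrightarrow> s \<le> t \<longrightarrow> t \<le> b \<longrightarrow> {s..t} \<subseteq> U \<longrightarrow> g t - g s \<le> W t - W s)"
      by (rule falls_on_compact_bound[OF g ab e, of K r']) (use K Eg in blast)+
    obtain U where U: "open U" "K \<subseteq> U" "U \<subseteq> {a<..<b}" "open (U - K)" "U - K \<in> lmeasurable"
      "measure lebesgue (U - K) < min d1 d2"
      using small_outer_open[of K a b UNIV "min d1 d2"] K E d1 d2 by auto
    obtain W1 where W1: "mono_on {a..b} W1" "W1 b - W1 a \<le> e / 2"
      "\<And>s t. a \<le> s \<Longrightarrow> s \<le> t \<Longrightarrow> t \<le> b \<Longrightarrow> {s..t} \<subseteq> U \<Longrightarrow> f t - f s \<le> W1 t - W1 s"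
      using D1[of U] U by auto
    obtain W2 where W2: "mono_on {a..b} W2" "W2 b - W2 a \<le> e / 2"
      "\<And>s t. a \<le> s \<Longrightarrow> s \<le> t \<Longrightarrow> t \<le> b \<Longrightarrow> {s..t} \<subseteq> U \<Longrightarrow> g t - g s \<le> W2 t - W2 s"
      using D2[of U] U by auto
    have "c * measure lebesgue K \<le> (W1 b + W2 b) - (W1 a + W2 a)"
    proof (rule measure_compact_le_increment[OF K(1) U(2) U(1) U(3) ab])
      show "mono_on {a..b} (\<lambda>x. W1 x + W2 x)"
        using W1(1) W2(1) by (auto simp: mono_on_def intro!: add_mono)
      fix s t assume st: "a \<le> s" "s \<le> t" "t \<le> b" "{s..t} \<subseteq> U"
      show "c * (t - s) \<le> W1 t + W2 t - (W1 s + W2 s)"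
        using W1(3)[OF st] W2(3)[OF st] fg[of s] fg[of t] by (simp add: right_diff_distrib)
    qed (use c in auto)
    then show ?thesis using W1(2) W2(2) by simp
  qed
  then have "c * measure lebesgue K \<le> 0" by (rule field_le_epsilon)
  then show "measure lebesgue K \<le> 0" using c by (simp add: mult_le_0_iff)
qed

text \<open>On intervals near a compact \<open>K\<close>, \<open>n\<close> times the length is at
  most the increment of \<open>f\<close> plus that of a monotone error function. Locally both are
  controlled by a total growth of at most 1, so \<open>n * measure lebesgue K\<close> is at most 2
  for every \<open>n\<close>.\<close>

lemma negligible_infinite_slope:
  assumes ab: "a \<le> b" and f: "absolutely_continuous_on_Icc a b f"
    and E: "E \<in> sets lebesgue" "E \<subseteq> {a<..<b}"
    and Ef: "\<And>x n. x \<in> E \<Longrightarrow> falls r (\<lambda>v. real n * v - f v) x"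
  shows "negligible E"
proof -
  obtain d where d: "d > 0" and D: "\<And>V. V \<in> lmeasurable \<Longrightarrow> measure lebesgue V < d \<Longrightarrow>
       \<exists>W. mono_on {a..b} W \<and> W b - W a \<le> 1 \<and>
         (\<forall>u v. a \<le> u \<longrightarrow> u \<le> v \<longrightarrow> v \<le> b \<longrightarrow> {u<..<v} \<subseteq> V \<longrightarrow> \<bar>f v - f u\<bar> \<le> W v - W u)"
    by (rule AC_variation_on_small_set[OF f ab, of 1]) auto
  \<comment> \<open>The ball has length \<open>2 * d / 3 < d\<close>, which makes it a small set in
    the sense of \<open>D\<close>.\<close>
  have loc: "negligible (E \<inter> ball z (d / 3))" for z
  proof (rule negligible_if_compact_subsets)
    show "E \<inter> ball z (d / 3) \<in> sets lebesgue" using E by auto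
    show "bounded (E \<inter> ball z (d / 3))" by (simp add: bounded_Int)
    fix K assume K: "compact K" "K \<subseteq> E \<inter> ball z (d / 3)"
    have "real n * measure lebesgue K \<le> 2" for n
    proof -
      have g: "absolutely_continuous_on_Icc a b (\<lambda>v. real n * v - f v)"
        using AC_add[OF AC_linear[of a b "real n"] AC_uminus[OF f]] by simp
      obtain d2 where d2: "d2 > 0" and
        D2: "\<And>U. open (U - K) \<Longrightarrow> U - K \<in> lmeasurable \<Longrightarrow> measure lebesgue (U - K) < d2 \<Longrightarrow>
         \<exists>W. mono_on {a..b} W \<and> W b - W a \<le> 1 \<and>
           (\<forall>s t. a \<le> s \<longrightarrow> s \<le> t \<longrightarrow> t \<le> b \<longrightarrow> {s..t} \<subseteq> U \<longrightarrow>
              (real n * t - f t) - (real n * s - f s) \<le> W t - W s)"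
        by (rule falls_on_compact_bound[OF g ab zero_less_one, of K r]) (use K Ef in blast)+
      obtain U where U: "open U" "K \<subseteq> U" "U \<subseteq> {a<..<b}" "U \<subseteq> ball z (d / 3)"
        "open (U - K)" "U - K \<in> lmeasurable" "measure lebesgue (U - K) < d2"
        using small_outer_open[of K a b "ball z (d / 3)" d2] K E d2 by auto
      obtain W2 where W2: "mono_on {a..b} W2" "W2 b - W2 a \<le> 1"
        "\<And>s t. a \<le> s \<Longrightarrow> s \<le> t \<Longrightarrow> t \<le> b \<Longrightarrow> {s..t} \<subseteq> U \<Longrightarrow>
           (real n * t - f t) - (real n * s - f s) \<le> W2 t - W2 s"
        using D2[of U] U by auto
      have "measure lebesgue (ball z (d / 3)) < d"
        using d by (simp add: ball_eq_greaterThanLessThan)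
      then obtain W1 where W1: "mono_on {a..b} W1" "W1 b - W1 a \<le> 1" and
        fW1: "\<And>u v. a \<le> u \<Longrightarrow> u \<le> v \<Longrightarrow> v \<le> b \<Longrightarrow> {u<..<v} \<subseteq> ball z (d / 3) \<Longrightarrow>
           \<bar>f v - f u\<bar> \<le> W1 v - W1 u"
        using D[of "ball z (d / 3)"] by auto
      have "real n * measure lebesgue K \<le> (W1 b + W2 b) - (W1 a + W2 a)"
      proof (rule measure_compact_le_increment[OF K(1) U(2) U(1) U(3) ab])
        show "mono_on {a..b} (\<lambda>x. W1 x + W2 x)"
          using W1(1) W2(1) by (auto simp: mono_on_def intro!: add_mono)
        fix s t assume st: "a \<le> s" "s \<le> t" "t \<le> b" "{s..t} \<subseteq> U"
        have "{s<..<t} \<subseteq> {s..t}" by auto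
        then have "\<bar>f t - f s\<bar> \<le> W1 t - W1 s" using st U by (intro fW1) auto
        then show "real n * (t - s) \<le> W1 t + W2 t - (W1 s + W2 s)"
          using W2(3)[OF st] by (simp add: right_diff_distrib)
      qed simp
      then show ?thesis using W1(2) W2(2) by simp
    qed
    then show "measure lebesgue K \<le> 0"
      by (metis reals_Archimedean3 not_le)
  qed
  \<comment> \<open>Negligibility is a local property, so the result for balls of this fixed radius
    suffices.\<close>
  show ?thesis
    unfolding locally_negligible_alt[of E]
  proof (intro ballI exI conjI)
    fix x assume "x \<in> E"
    show "openin (top_of_set E) (E \<inter> ball x (d / 3))" by (rule openin_open_Int) simp
    show "x \<in> E \<inter> ball x (d / 3)" using d \<open>x \<in> E\<close> by simp
    show "negligible (E \<inter> ball x (d / 3))" by (rule loc)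
  qed
qed

section \<open>Measurability of the sets of falling points\<close>

lemma falls_left_reflect: "falls False f x \<longleftrightarrow> falls True (\<lambda>v. - f (- v)) (- x)"
  by (simp add: falls_def at_left_minus[of x] frequently_def eventually_filtermap)

text \<open>The set is a G-delta: for each \<open>n\<close>, having a lower value within distance
  \<open>1 / (n + 1)\<close> to the right is an open condition because \<open>f\<close> is
  continuous.\<close>

lemma sets_falls_right:
  assumes f: "continuous_on {a<..<b} f"
  shows "{x\<in>{a<..<b}. falls True f x} \<in> sets borel"
proof -
  define G where "G n = (\<Union>v\<in>{a<..<b}. {x\<in>{a<..<b}. f x \<in> {f v<..}} \<inter> {v - inverse (Suc n)<..<v})" for n :: nat
  have "open (G n)" for n
    unfolding G_def
    by (intro open_UN ballI open_Int open_greaterThanLessThan)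
      (rule continuous_open_preimage[OF f, unfolded vimage_def Int_def mem_Collect_eq]; simp)
  then have "(\<Inter>n. G n) \<in> sets borel" by auto
  moreover have "{x\<in>{a<..<b}. falls True f x} = (\<Inter>n. G n)"
  proof (intro set_eqI iffI)
    fix x assume x: "x \<in> {x\<in>{a<..<b}. falls True f x}"
    show "x \<in> (\<Inter>n. G n)"
    proof
      fix n :: nat
      have "\<exists>\<^sub>F v in at_right x. f v < f x" using x by (simp add: falls_def)
      moreover have "\<forall>\<^sub>F v in at_right x. v \<in> {x<..<min b (x + inverse (Suc n))}"
        by (rule eventually_at_right_real) (use x in auto)
      ultimately have "\<exists>\<^sub>F v in at_right x. f v < f x \<and> v \<in> {x<..<min b (x + inverse (Suc n))}"
        by (rule frequently_rev_mp[OF _ eventually_mono]) auto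
      then obtain v where "f v < f x" "v \<in> {x<..<min b (x + inverse (Suc n))}"
        by (auto dest: frequently_ex)
      then show "x \<in> G n" using x unfolding G_def by (intro UN_I[of v]) auto
    qed
  next
    fix x assume "x \<in> (\<Inter>n. G n)"
    then have G: "x \<in> G n" for n by auto
    have "\<exists>\<^sub>F v in at_right x. f v < f x"
      unfolding frequently_def eventually_at_right_field
    proof
      assume "\<exists>c>x. \<forall>y>x. y < c \<longrightarrow> \<not> f y < f x"
      then obtain c where c: "c > x" "\<And>y. y > x \<Longrightarrow> y < c \<Longrightarrow> \<not> f y < f x" by blast
      then obtain n where n: "inverse (real (Suc n)) < c - x"
        using reals_Archimedean[of "c - x"] by auto
      show False using G[of n] n c(2) unfolding G_def by force
    qed
    then show "x \<in> {x\<in>{a<..<b}. falls True f x}" using G[of 0] by (auto simp: G_def falls_def)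
  qed
  ultimately show ?thesis by simp
qed

lemma sets_falls:
  assumes f: "continuous_on {a<..<b} f"
  shows "{x\<in>{a<..<b}. falls r f x} \<in> sets borel"
proof (cases r)
  case True
  then show ?thesis using sets_falls_right[OF f] by simp
next
  case False
  have "continuous_on {- b<..<- a} (\<lambda>v. - f (- v))"
    by (intro continuous_intros continuous_on_compose2[OF f]) auto
  from sets_falls_right[OF this]
  have "uminus -` {x\<in>{- b<..<- a}. falls True (\<lambda>v. - f (- v)) x} \<inter> space borel \<in> sets borel"
    by (intro measurable_sets[of uminus borel borel]) auto
  also have "uminus -` {x\<in>{- b<..<- a}. falls True (\<lambda>v. - f (- v)) x} \<inter> space borel
      = {x\<in>{a<..<b}. falls r f x}"
    using False by (auto simp: falls_left_reflect)
  finally show ?thesis .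
qed

section \<open>From failing differentiability to falling points\<close>

text \<open>After multiplication by \<open>v - x\<close>, whose sign depends on the side, a slope
  below \<open>p\<close> is a fall of \<open>f v - p * v\<close> on that side; what is frequent near
  \<open>x\<close> is frequent on at least one side.\<close>

lemma frequently_slope_less_imp_falls:
  fixes f :: "real \<Rightarrow> real"
  assumes "\<exists>\<^sub>F v in at x. (f v - f x) / (v - x) < p"
  shows "\<exists>r. falls r (\<lambda>v. f v - p * v) x"
proof (rule ccontr)
  assume "\<nexists>r. falls r (\<lambda>v. f v - p * v) x"
  then have "\<not> falls True (\<lambda>v. f v - p * v) x" "\<not> falls False (\<lambda>v. f v - p * v) x" by auto
  then have R: "\<forall>\<^sub>F v in at_right x. f x - p * x \<le> f v - p * v"
    and L: "\<forall>\<^sub>F v in at_left x. f v - p * v \<le> f x - p * x"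
    by (auto simp: falls_def frequently_def not_less)
  have "\<forall>\<^sub>F v in at_right x. \<not> (f v - f x) / (v - x) < p"
    using R unfolding eventually_at_filter by (rule eventually_mono) (auto simp: field_simps)
  moreover have "\<forall>\<^sub>F v in at_left x. \<not> (f v - f x) / (v - x) < p"
    using L unfolding eventually_at_filter by (rule eventually_mono) (auto simp: field_simps)
  ultimately have "\<forall>\<^sub>F v in at x. \<not> (f v - f x) / (v - x) < p" by (simp add: eventually_at_split)
  then show False using assms by (simp add: frequently_def)
qed

lemma frequently_slope_greater_imp_falls:
  fixes f :: "real \<Rightarrow> real"
  assumes "\<exists>\<^sub>F v in at x. q < (f v - f x) / (v - x)"
  shows "\<exists>r. falls r (\<lambda>v. q * v - f v) x"
proof -
  have "\<exists>\<^sub>F v in at x. ((- f v) - (- f x)) / (v - x) < - q"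
    using assms by (rule frequently_elim1) (simp add: field_simps add_divide_distrib diff_divide_distrib)
  from frequently_slope_less_imp_falls[OF this] show ?thesis by (simp add: algebra_simps)
qed

text \<open>\<open>p * v - f v\<close> arises from \<open>q * v - f v\<close> by adding the
  nonincreasing function \<open>(p - q) * v\<close>, which keeps every fall.\<close>

lemma falls_slope_mono:
  assumes "falls r (\<lambda>v. q * v - f v) x" "p \<le> q"
  shows "falls r (\<lambda>v. p * v - f v) x"
proof -
  have *: "p * v - p * x \<le> q * v - q * x" if "x < v" for v
    using mult_right_mono[OF assms(2), of "v - x"] that by (simp add: algebra_simps)
  have **: "q * v - q * x \<le> p * v - p * x" if "v < x" for v
    using mult_right_mono[OF assms(2), of "x - v"] that by (simp add: algebra_simps)
  have 1: "\<forall>\<^sub>F v in at_right x. q * v - f v < q * x - f x \<longrightarrow> p * v - f v < p * x - f x"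
    unfolding eventually_at_filter by (rule always_eventually) (use * in fastforce)
  have 2: "\<forall>\<^sub>F v in at_left x. q * x - f x < q * v - f v \<longrightarrow> p * x - f x < p * v - f v"
    unfolding eventually_at_filter by (rule always_eventually) (use ** in fastforce)
  show ?thesis
    using assms(1) frequently_rev_mp[OF _ 1] frequently_rev_mp[OF _ 2] unfolding falls_def
    by (auto split: if_splits)
qed

text \<open>The limit is the supremum of the eventual lower bounds, that is, the limit inferior.
  Rational levels suffice since two of them fit between it and any larger \<open>y\<close>, and they
  will keep the exceptional set a countable union.\<close>

lemma tendsto_if_no_rational_oscillation:
  fixes Q :: "'a \<Rightarrow> real"
  assumes F: "F \<noteq> bot" and lo: "\<forall>\<^sub>F v in F. m \<le> Q v" and hi: "\<forall>\<^sub>F v in F. Q v \<le> M"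
    and osc: "\<And>p q. p \<in> \<rat> \<Longrightarrow> q \<in> \<rat> \<Longrightarrow> p < q \<Longrightarrow> \<exists>\<^sub>F v in F. Q v < p \<Longrightarrow> \<forall>\<^sub>F v in F. Q v \<le> q"
  shows "\<exists>l. (Q \<longlongrightarrow> l) F"
proof -
  define S where "S = {p. \<forall>\<^sub>F v in F. p \<le> Q v}"
  have bdd: "bdd_above S"
  proof (rule bdd_aboveI)
    fix p assume "p \<in> S"
    then have "\<forall>\<^sub>F v in F. p \<le> Q v \<and> Q v \<le> M" using hi by (simp add: S_def eventually_conj)
    then obtain v where "p \<le> Q v \<and> Q v \<le> M" using F eventually_happens' by blast
    then show "p \<le> M" by simp
  qed
  have ne: "m \<in> S" using lo by (simp add: S_def)
  have "(Q \<longlongrightarrow> Sup S) F"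
  proof (rule order_tendstoI)
    fix y assume "y < Sup S"
    then obtain p where "p \<in> S" "y < p" using less_cSup_iff[of S y] bdd ne by blast
    then show "\<forall>\<^sub>F v in F. y < Q v" unfolding S_def by (auto elim: eventually_mono)
  next
    fix y assume "Sup S < y"
    then obtain q where q: "q \<in> \<rat>" "Sup S < q" "q < y" using Rats_dense_in_real by blast
    then obtain p where p: "p \<in> \<rat>" "Sup S < p" "p < q" using Rats_dense_in_real by blast
    have "p \<notin> S" using cSup_upper[OF _ bdd] p by fastforce
    then have "\<exists>\<^sub>F v in F. Q v < p" by (simp add: S_def not_eventually not_le)
    from osc[OF p(1) q(1) p(3) this] show "\<forall>\<^sub>F v in F. Q v < y"
      by (rule eventually_mono) (use q in auto)
  qed
  then show ?thesis by blast
qed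

text \<open>If the second and third alternatives fail, the difference quotients are bounded above
  and below near \<open>x\<close>; if the first fails, they do not oscillate across two rational
  levels. Then they converge.\<close>

lemma not_differentiable_imp_falls:
  fixes f :: "real \<Rightarrow> real"
  assumes nd: "\<not> f differentiable (at x)"
  shows "(\<exists>p\<in>\<rat>. \<exists>q\<in>\<rat>. p < q \<and> (\<exists>r r'. falls r (\<lambda>v. f v - p * v) x \<and> falls r' (\<lambda>v. q * v - f v) x)) \<or>
    (\<exists>r. \<forall>n. falls r (\<lambda>v. real n * v - f v) x) \<or> (\<exists>r. \<forall>n. falls r (\<lambda>v. real n * v - - f v) x)"
    (is "?A \<or> ?B f \<or> ?B (\<lambda>v. - f v)")
proof (rule ccontr)
  assume con: "\<not> (?A \<or> ?B f \<or> ?B (\<lambda>v. - f v))"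
  have bound: "\<exists>n. \<forall>\<^sub>F v in at x. (g v - g x) / (v - x) \<le> real n" if "\<not> ?B g" for g :: "real \<Rightarrow> real"
  proof -
    obtain n1 n2 where n: "\<not> falls True (\<lambda>v. real n1 * v - g v) x" "\<not> falls False (\<lambda>v. real n2 * v - g v) x"
      using \<open>\<not> ?B g\<close> by blast
    \<comment> \<open>Each side has its own bound; by \<open>falls_slope_mono\<close> the larger one
      serves both.\<close>
    define n where "n = max n1 n2"
    have "\<not> falls r (\<lambda>v. real n * v - g v) x" for r
      using n falls_slope_mono[of r "real n" g x "real n1"] falls_slope_mono[of r "real n" g x "real n2"]
      by (cases r) (auto simp: n_def)
    then have "\<not> (\<exists>\<^sub>F v in at x. real n < (g v - g x) / (v - x))"
      using frequently_slope_greater_imp_falls by blast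
    then show ?thesis by (auto simp: not_frequently not_less)
  qed
  obtain n where n: "\<forall>\<^sub>F v in at x. (f v - f x) / (v - x) \<le> real n" using bound[of f] con by blast
  obtain m where "\<forall>\<^sub>F v in at x. (- f v - - f x) / (v - x) \<le> real m"
    using bound[of "\<lambda>v. - f v"] con by blast
  then have m: "\<forall>\<^sub>F v in at x. - real m \<le> (f v - f x) / (v - x)"
    by (rule eventually_mono) (simp add: field_simps diff_divide_distrib)
  have "\<exists>l. ((\<lambda>v. (f v - f x) / (v - x)) \<longlongrightarrow> l) (at x)"
  proof (rule tendsto_if_no_rational_oscillation[OF _ m n])
    fix p q :: real assume pq: "p \<in> \<rat>" "q \<in> \<rat>" "p < q" "\<exists>\<^sub>F v in at x. (f v - f x) / (v - x) < p"
    show "\<forall>\<^sub>F v in at x. (f v - f x) / (v - x) \<le> q"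
    proof (rule ccontr)
      assume "\<not> ?thesis"
      then have "\<exists>\<^sub>F v in at x. q < (f v - f x) / (v - x)" by (simp add: not_eventually not_le)
      then show False
        using con frequently_slope_greater_imp_falls[of q f x] frequently_slope_less_imp_falls[OF pq(4)] pq
        by blast
    qed
  qed simp
  then show False using nd by (auto simp: real_differentiable_def has_field_derivative_iff)
qed

text \<open>Every bad point inside the interval lies in one of countably many sets, indexed by
  rational slopes and by sides, to which \<open>negligible_both_fall\<close> or
  \<open>negligible_infinite_slope\<close> applies.\<close>

theorem AC_differentiable_almost_everywhere:
  assumes f: "absolutely_continuous_on_Icc a b f"
  shows "negligible {x\<in>{a..b}. \<not> f differentiable (at x)}"
proof (cases "a \<le> b")
  case ab: True
  define D where "D r g = {x\<in>{a<..<b}. falls r g x}" for r g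
  have ac1: "absolutely_continuous_on_Icc a b (\<lambda>v. f v - p * v)" for p
    using AC_add[OF f AC_uminus[OF AC_linear[of a b p]]] by simp
  have ac2: "absolutely_continuous_on_Icc a b (\<lambda>v. p * v - f v)" for p
    using AC_add[OF AC_linear[of a b p] AC_uminus[OF f]] by simp
  have ac3: "absolutely_continuous_on_Icc a b (\<lambda>v. p * v - - f v)" for p
    using AC_add[OF AC_linear[of a b p] f] by simp
  have meas: "D r g \<in> sets lebesgue" if "absolutely_continuous_on_Icc a b g" for r g
  proof -
    have "continuous_on {a<..<b} g"
      by (rule continuous_on_subset[OF AC_imp_continuous_on[OF that]]) auto
    from sets_falls[OF this, of r] show ?thesis by (simp add: D_def)
  qed
  have n1: "negligible (D r (\<lambda>v. f v - p * v) \<inter> D r' (\<lambda>v. q * v - f v))" if "p < q" for p q r r'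
    by (rule negligible_both_fall[OF ab ac1[of p] ac2[of q], of "q - p" _ r r'])
      (use that meas[OF ac1] meas[OF ac2] in \<open>auto simp: D_def left_diff_distrib\<close>)
  have n2: "negligible (\<Inter>n. D r (\<lambda>v. real n * v - f v))" for r
  proof (rule negligible_infinite_slope[OF ab f, of _ r])
    show "(\<Inter>n. D r (\<lambda>v. real n * v - f v)) \<in> sets lebesgue" using meas[OF ac2] by blast
  qed (auto simp: D_def)
  have n3: "negligible (\<Inter>n. D r (\<lambda>v. real n * v - - f v))" for r
  proof (rule negligible_infinite_slope[OF ab AC_uminus[OF f], of _ r])
    show "(\<Inter>n. D r (\<lambda>v. real n * v - - f v)) \<in> sets lebesgue" using meas[OF ac3] by blast
  qed (auto simp: D_def)
  define M where "M p q = (\<Union>r. \<Union>r'. D r (\<lambda>v. f v - p * v) \<inter> D r' (\<lambda>v. q * v - f v))" for p q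
  have "negligible (M p q)" if "p < q" for p q
    unfolding M_def
    by (intro negligible_Union finite_imageI finite_class.finite | elim imageE | hypsubst | rule n1[OF that])+
  define N1 where "N1 = (\<Union>p\<in>\<rat>. \<Union>q\<in>\<rat> \<inter> {p<..}. M p q)"
  have "negligible N1"
    unfolding N1_def
    by (intro negligible_countable_Union countable_image countable_rat countable_Int1)
      (auto intro!: negligible_countable_Union \<open>\<And>p q. p < q \<Longrightarrow> negligible (M p q)\<close> simp: countable_rat)
  moreover have "negligible (\<Union>r. \<Inter>n. D r (\<lambda>v. real n * v - f v))"
    "negligible (\<Union>r. \<Inter>n. D r (\<lambda>v. real n * v - - f v))"
    using n2 n3 by (auto intro!: negligible_countable_Union)
  \<comment> \<open>The end points are added because \<open>f\<close> is unconstrained outside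
    \<open>[a, b]\<close>, so nothing is known about a two-sided derivative there.\<close>
  ultimately have neg: "negligible (N1 \<union> (\<Union>r. \<Inter>n. D r (\<lambda>v. real n * v - f v)) \<union>
      (\<Union>r. \<Inter>n. D r (\<lambda>v. real n * v - - f v)) \<union> {a, b})" (is "negligible ?N")
    by auto
  show ?thesis
  proof (rule negligible_subset[OF neg], rule subsetI)
    fix x assume x: "x \<in> {x\<in>{a..b}. \<not> f differentiable (at x)}"
    show "x \<in> ?N"
    proof (cases "x \<in> {a<..<b}")
      case True
      then show ?thesis using not_differentiable_imp_falls[of f x] x by (auto simp: N1_def M_def D_def)
    qed (use x in auto)
  qed
qed simp

section \<open>Fractional integrals as convolutions\<close>

text \<open>Only the values of \<open>f\<close> on \<open>[a, b]\<close> enter, whereas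
  \<open>k\<close> lives on the whole line, so one kernel can describe left and right integrals
  alike. The measure \<open>lborel\<close> gives direct access to Fubini's theorem and affine
  substitution.\<close>

definition conv :: "real \<Rightarrow> real \<Rightarrow> (real \<Rightarrow> real) \<Rightarrow> (real \<Rightarrow> real) \<Rightarrow> real \<Rightarrow> real" where
  "conv a b k f x = (LINT t:{a..b}|lborel. k (x - t) * f t)"

lemma integrable_lborel_reflect:
  fixes k :: "real \<Rightarrow> real"
  assumes "integrable lborel k"
  shows "integrable lborel (\<lambda>t. k (x - t))"
  using lborel_integrable_real_affine[OF assms, of "-1" x] by simp

lemma continuous_on_Icc_indicator:
  fixes f :: "real \<Rightarrow> real"
  assumes "continuous_on {a..b} f"
  shows "(\<lambda>t. indicator {a..b} t * f t) \<in> borel_measurable borel"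
    and "\<exists>M. \<forall>t. \<bar>indicator {a..b} t * f t\<bar> \<le> M"
    and "integrable lborel (\<lambda>t. indicator {a..b} t * f t)"
proof -
  show "(\<lambda>t. indicator {a..b} t * f t) \<in> borel_measurable borel"
    using borel_measurable_continuous_on_indicator[OF _ assms] by simp
  have "bounded (f ` {a..b})" using assms by (intro compact_imp_bounded compact_continuous_image) auto
  then obtain M where "\<forall>t\<in>{a..b}. \<bar>f t\<bar> \<le> M" by (auto simp: bounded_iff)
  then show "\<exists>M. \<forall>t. \<bar>indicator {a..b} t * f t\<bar> \<le> M"
    by (intro exI[of _ "max 0 M"]) (auto simp: indicator_def intro: max.coboundedI2)
  show "integrable lborel (\<lambda>t. indicator {a..b} t * f t)"
    using borel_integrable_compact[OF _ assms] by simp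
qed

lemma conv_integrable:
  fixes k f :: "real \<Rightarrow> real"
  assumes k: "integrable lborel k" and f: "continuous_on {a..b} f"
  shows "integrable lborel (\<lambda>t. k (x - t) * (indicator {a..b} t * f t))"
proof -
  obtain M where M: "\<And>t. \<bar>indicator {a..b} t * f t\<bar> \<le> M" using continuous_on_Icc_indicator(2)[OF f] by blast
  note [measurable] = continuous_on_Icc_indicator(1)[OF f] borel_measurable_integrable[OF integrable_lborel_reflect[OF k]]
  show ?thesis
  proof (rule Bochner_Integration.integrable_bound)
    show "integrable lborel (\<lambda>t. M * k (x - t))"
      using integrable_lborel_reflect[OF k] by simp
    have "\<bar>k (x - t)\<bar> * \<bar>indicator {a..b} t * f t\<bar> \<le> M * \<bar>k (x - t)\<bar>" for t
      using mult_left_mono[OF M[of t], of "\<bar>k (x - t)\<bar>"] by (simp add: mult.commute)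
    moreover have "M \<ge> 0" using M[of 0] by linarith
    ultimately show "AE t in lborel. norm (k (x - t) * (indicator {a..b} t * f t)) \<le> norm (M * k (x - t))"
      by (simp add: abs_mult)
  qed measurable
qed

lemma conv_eq: "conv a b k f x = (\<integral>t. k (x - t) * (indicator {a..b} t * f t) \<partial>lborel)"
  unfolding conv_def set_lebesgue_integral_def by (intro Bochner_Integration.integral_cong) (auto simp: mult_ac)

text \<open>Substituting \<open>s = x - t\<close> moves \<open>x\<close> from the possibly singular
  kernel to the cut-off function, which is bounded and continuous except at \<open>a\<close> and
  \<open>b\<close>; dominated convergence then applies.\<close>

lemma continuous_on_conv:
  fixes k f :: "real \<Rightarrow> real"
  assumes k: "integrable lborel k" and f: "continuous_on {a..b} f"
  shows "continuous_on S (conv a b k f)"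
proof -
  define F where "F t = indicator {a..b} t * f t" for t
  obtain M where M: "\<And>t. \<bar>F t\<bar> \<le> M" using continuous_on_Icc_indicator(2)[OF f] unfolding F_def by blast
  have Fm[measurable]: "F \<in> borel_measurable borel"
    using continuous_on_Icc_indicator(1)[OF f] unfolding F_def .
  note km[measurable] = borel_measurable_integrable[OF k]
  have eq: "conv a b k f x = (\<integral>s. k s * F (x - s) \<partial>lborel)" for x
    using lborel_integral_real_affine[of "-1" "\<lambda>t. k (x - t) * F t" x] by (simp add: conv_eq F_def)
  have contF: "isCont F t" if "t \<noteq> a" "t \<noteq> b" for t
  proof (cases "t \<in> {a<..<b}")
    case True
    have "continuous_on {a<..<b} f" by (rule continuous_on_subset[OF f]) auto
    then have "isCont f t" using True by (simp add: continuous_on_eq_continuous_at)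
    moreover have "\<forall>\<^sub>F s in nhds t. F s = f s"
      using eventually_nhds_in_open[OF open_greaterThanLessThan True]
      by (rule eventually_mono) (auto simp: F_def)
    ultimately show ?thesis using isCont_cong by blast
  next
    case False
    then have "t \<in> - {a..b}" using that by auto
    then have "\<forall>\<^sub>F s in nhds t. s \<in> - {a..b}" by (intro eventually_nhds_in_open) auto
    then have "\<forall>\<^sub>F s in nhds t. F s = 0" by (rule eventually_mono) (auto simp: F_def)
    then show ?thesis using isCont_cong[of F "\<lambda>_. 0" t] by simp
  qed
  show ?thesis
  proof (rule continuous_on_sequentiallyI)
    fix u :: "nat \<Rightarrow> real" and x assume u: "u \<longlonglongrightarrow> x"
    show "(\<lambda>n. conv a b k f (u n)) \<longlonglongrightarrow> conv a b k f x"
      unfolding eq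
    proof (rule integral_dominated_convergence)
      show "integrable lborel (\<lambda>s. M * \<bar>k s\<bar>)" using k by (intro integrable_mult_right integrable_abs)
      \<comment> \<open>The possible jumps of \<open>F\<close> at \<open>a\<close> and
        \<open>b\<close> are met only at these two values of \<open>s\<close>.\<close>
      have "AE s in lborel. s \<notin> {x - a, x - b}"
        by (intro AE_not_in finite_imp_null_set_lborel) auto
      then show "AE s in lborel. (\<lambda>n. k s * F (u n - s)) \<longlonglongrightarrow> k s * F (x - s)"
      proof eventually_elim
        case (elim s)
        then have "isCont F (x - s)" by (intro contF) auto
        then show ?case by (intro tendsto_intros isCont_tendsto_compose[of "x - s" F] u)
      qed
      have "\<bar>k s\<bar> * \<bar>F (u n - s)\<bar> \<le> M * \<bar>k s\<bar>" for s n
        using mult_right_mono[OF M[of "u n - s"], of "\<bar>k s\<bar>"] by (simp add: mult.commute)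
      then show "AE s in lborel. norm (k s * F (u n - s)) \<le> M * \<bar>k s\<bar>" for n
        by (simp add: abs_mult)
    qed measurable
  qed
qed

text \<open>Fubini's theorem; the reflection appears because \<open>x - t\<close> is read as
  \<open>- (t - x)\<close>. For power kernels this is fractional integration by parts.\<close>

lemma conv_adjoint:
  assumes k: "integrable lborel k" and f: "continuous_on {a..b} f" and g: "continuous_on {a..b} g"
  shows "(LINT x:{a..b}|lborel. g x * conv a b k f x) = (LINT x:{a..b}|lborel. f x * conv a b (\<lambda>s. k (- s)) g x)"
proof -
  define F where "F t = indicator {a..b} t * f t" for t
  define G where "G t = indicator {a..b} t * g t" for t
  have [measurable]: "F \<in> borel_measurable borel" "G \<in> borel_measurable borel"
    using continuous_on_Icc_indicator(1)[OF f] continuous_on_Icc_indicator(1)[OF g] unfolding F_def G_def by auto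
  have [measurable]: "k \<in> borel_measurable borel" using borel_measurable_integrable[OF k] by simp
  have int: "integrable lborel (\<lambda>t. k (x - t) * F t)" for x
    using conv_integrable[OF k f] by (simp add: F_def)
  \<comment> \<open>The iterated integral of the absolute values is again of convolution form, hence
    continuous and integrable over \<open>[a, b]\<close>.\<close>
  have kf: "continuous_on {a..b} (\<lambda>x. \<bar>g x\<bar> * conv a b (\<lambda>s. \<bar>k s\<bar>) (\<lambda>t. \<bar>f t\<bar>) x)"
    using k f g by (intro continuous_intros continuous_on_conv) auto
  have "integrable (lborel \<Otimes>\<^sub>M lborel) (\<lambda>(x, t). G x * (k (x - t) * F t))"
  proof (rule lborel_pair.Fubini_integrable)
    have "(\<integral>t. norm (case (x, t) of (x, t) \<Rightarrow> G x * (k (x - t) * F t)) \<partial>lborel)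
        = indicator {a..b} x * (\<bar>g x\<bar> * conv a b (\<lambda>s. \<bar>k s\<bar>) (\<lambda>t. \<bar>f t\<bar>) x)" for x
    proof -
      have "(\<integral>t. norm (case (x, t) of (x, t) \<Rightarrow> G x * (k (x - t) * F t)) \<partial>lborel)
          = (\<integral>t. \<bar>G x\<bar> * (\<bar>k (x - t)\<bar> * (indicator {a..b} t * \<bar>f t\<bar>)) \<partial>lborel)"
        by (simp add: F_def abs_mult)
      then show ?thesis by (simp add: conv_eq G_def abs_mult)
    qed
    then show "integrable lborel (\<lambda>x. \<integral>t. norm (case (x, t) of (x, t) \<Rightarrow> G x * (k (x - t) * F t)) \<partial>lborel)"
      using continuous_on_Icc_indicator(3)[OF kf] by simp
    show "AE x in lborel. integrable lborel (\<lambda>t. case (x, t) of (x, t) \<Rightarrow> G x * (k (x - t) * F t))"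
      using int by simp
  qed measurable
  then have "(\<integral>t. (\<integral>x. G x * (k (x - t) * F t) \<partial>lborel) \<partial>lborel) = (\<integral>x. (\<integral>t. G x * (k (x - t) * F t) \<partial>lborel) \<partial>lborel)"
    by (rule lborel_pair.Fubini_integral)
  moreover have "(\<integral>t. G x * (k (x - t) * F t) \<partial>lborel) = indicator {a..b} x * (g x * conv a b k f x)" for x
    by (simp add: conv_eq F_def G_def)
  moreover have "(\<integral>x. G x * (k (x - t) * F t) \<partial>lborel) = indicator {a..b} t * (f t * conv a b (\<lambda>s. k (- s)) g t)" for t
  proof -
    have "(\<integral>x. G x * (k (x - t) * F t) \<partial>lborel) = (\<integral>x. F t * (k (x - t) * G x) \<partial>lborel)"
      by (simp add: mult_ac)
    then show ?thesis by (simp add: conv_eq F_def G_def)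
  qed
  ultimately show ?thesis by (simp add: set_lebesgue_integral_def)
qed

section \<open>Riemann--Liouville integrals as convolutions with a power kernel\<close>

text \<open>The cut-off at \<open>c\<close> makes the Riemann--Liouville kernel integrable over the
  line. With \<open>c = b - a\<close> it loses no nonnegative difference of two points of
  \<open>[a, b]\<close>.\<close>

definition power_kernel :: "real \<Rightarrow> real \<Rightarrow> real \<Rightarrow> real" where
  "power_kernel c \<alpha> s = indicator {0..c} s * s powr (\<alpha> - 1) / Gamma \<alpha>"

lemma integrable_power_kernel:
  assumes "\<alpha> > 0" "c \<ge> 0"
  shows "integrable lborel (power_kernel c \<alpha>)"
proof -
  have "(\<lambda>s. s powr (\<alpha> - 1)) integrable_on {0..c}" using assms by (intro integrable_on_powr_from_0) auto
  then have "(\<lambda>s. s powr (\<alpha> - 1)) absolutely_integrable_on {0..c}"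
    by (rule nonnegative_absolutely_integrable_1) simp
  then have "integrable lebesgue (\<lambda>s. indicator {0..c} s * s powr (\<alpha> - 1))"
    by (simp add: set_integrable_def)
  then have "integrable lborel (\<lambda>s. indicator {0..c} s * s powr (\<alpha> - 1))"
    by (simp add: integrable_completion)
  then show ?thesis unfolding power_kernel_def by simp
qed

lemma left_RL_conv:
  assumes \<alpha>: "\<alpha> > 0" and f: "continuous_on {a..b} f" and x: "x \<in> {a..b}"
  shows "left_RL_integral_exists a \<alpha> f x"
    and "left_RL_integral a \<alpha> f x = conv a b (power_kernel (b - a) \<alpha>) f x"
proof -
  have k: "integrable lborel (power_kernel (b - a) \<alpha>)" using \<alpha> x by (intro integrable_power_kernel) auto
  have G: "Gamma \<alpha> > 0" using \<alpha> by (rule Gamma_real_pos)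
  \<comment> \<open>For \<open>x\<close> and \<open>t\<close> in \<open>[a, b]\<close> the support
    condition on the kernel at \<open>x - t\<close> amounts to \<open>t \<le> x\<close>.\<close>
  have eq: "(\<lambda>t. indicator {a..x} t * ((x - t) powr (\<alpha> - 1) * f t)) =
      (\<lambda>t. Gamma \<alpha> * (power_kernel (b - a) \<alpha> (x - t) * (indicator {a..b} t * f t)))"
    using G x by (intro ext) (auto simp: power_kernel_def indicator_def)
  have i: "integrable lborel (\<lambda>t. indicator {a..x} t * ((x - t) powr (\<alpha> - 1) * f t))"
    unfolding eq using conv_integrable[OF k f] by simp
  then show "left_RL_integral_exists a \<alpha> f x"
    by (simp add: left_RL_integral_exists_def set_integrable_def integrable_completion borel_measurable_integrable)
  have "(\<integral>t. indicator {a..x} t * ((x - t) powr (\<alpha> - 1) * f t) \<partial>lborel) = Gamma \<alpha> * conv a b (power_kernel (b - a) \<alpha>) f x"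
    unfolding eq conv_eq by simp
  then show "left_RL_integral a \<alpha> f x = conv a b (power_kernel (b - a) \<alpha>) f x"
    using i G by (simp add: left_RL_integral_def set_lebesgue_integral_def integral_completion borel_measurable_integrable)
qed

lemma right_RL_conv:
  assumes \<alpha>: "\<alpha> > 0" and f: "continuous_on {a..b} f" and x: "x \<in> {a..b}"
  shows "right_RL_integral_exists b \<alpha> f x"
    and "right_RL_integral b \<alpha> f x = conv a b (\<lambda>s. power_kernel (b - a) \<alpha> (- s)) f x"
proof -
  have "integrable lborel (power_kernel (b - a) \<alpha>)" using \<alpha> x by (intro integrable_power_kernel) auto
  from integrable_lborel_reflect[OF this, of 0]
  have k: "integrable lborel (\<lambda>s. power_kernel (b - a) \<alpha> (- s))" by simp
  have G: "Gamma \<alpha> > 0" using \<alpha> by (rule Gamma_real_pos)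
  have eq: "(\<lambda>t. indicator {x..b} t * ((t - x) powr (\<alpha> - 1) * f t)) =
      (\<lambda>t. Gamma \<alpha> * (power_kernel (b - a) \<alpha> (- (x - t)) * (indicator {a..b} t * f t)))"
    using G x by (intro ext) (auto simp: power_kernel_def indicator_def)
  have i: "integrable lborel (\<lambda>t. indicator {x..b} t * ((t - x) powr (\<alpha> - 1) * f t))"
    unfolding eq using conv_integrable[OF k f] by simp
  then show "right_RL_integral_exists b \<alpha> f x"
    by (simp add: right_RL_integral_exists_def set_integrable_def integrable_completion borel_measurable_integrable)
  have "(\<integral>t. indicator {x..b} t * ((t - x) powr (\<alpha> - 1) * f t) \<partial>lborel) = Gamma \<alpha> * conv a b (\<lambda>s. power_kernel (b - a) \<alpha> (- s)) f x"
    unfolding eq conv_eq by simp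
  then show "right_RL_integral b \<alpha> f x = conv a b (\<lambda>s. power_kernel (b - a) \<alpha> (- s)) f x"
    using i G by (simp add: right_RL_integral_def set_lebesgue_integral_def integral_completion borel_measurable_integrable)
qed

lemma conv_lincomb:
  assumes "integrable lborel k" "integrable lborel l" "continuous_on {a..b} f"
  shows "conv a b (\<lambda>s. p * k s + q * l s) f x = p * conv a b k f x + q * conv a b l f x"
proof -
  note i = conv_integrable[OF assms(1,3), of x] conv_integrable[OF assms(2,3), of x]
  have "conv a b (\<lambda>s. p * k s + q * l s) f x =
     (\<integral>t. p * (k (x - t) * (indicator {a..b} t * f t)) + q * (l (x - t) * (indicator {a..b} t * f t)) \<partial>lborel)"
    unfolding conv_eq by (simp add: algebra_simps)
  also have "\<dots> = p * conv a b k f x + q * conv a b l f x"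
    using i by (simp add: conv_eq)
  finally show ?thesis .
qed

text \<open>The combined Caputo derivative is convolution of the derivative with this kernel, and the
  integral underlying the dual Riemann--Liouville derivative is, up to sign, convolution with the
  reflected kernel.\<close>

definition Caputo_kernel :: "real \<Rightarrow> real \<Rightarrow> real \<Rightarrow> real \<Rightarrow> real \<Rightarrow> real" where
  "Caputo_kernel c \<alpha> \<beta> \<gamma> s = \<gamma> * power_kernel c (1 - \<alpha>) s + (\<gamma> - 1) * power_kernel c (1 - \<beta>) (- s)"

lemma integrable_Caputo_kernel:
  assumes "\<alpha> < 1" "\<beta> < 1" "c \<ge> 0"
  shows "integrable lborel (Caputo_kernel c \<alpha> \<beta> \<gamma>)"
proof -
  have "integrable lborel (\<lambda>s. power_kernel c (1 - \<beta>) (- s))"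
    using integrable_lborel_reflect[OF integrable_power_kernel[of "1 - \<beta>" c], of 0] assms by simp
  moreover have "integrable lborel (power_kernel c (1 - \<alpha>))"
    using assms by (intro integrable_power_kernel) auto
  ultimately show ?thesis unfolding Caputo_kernel_def by auto
qed

text \<open>Reflecting the kernel exchanges left and right integrals. This swaps
  \<open>\<alpha>\<close> with \<open>\<beta>\<close> and \<open>\<gamma>\<close> with
  \<open>1 - \<gamma>\<close>, which is where the dual operator of the Euler--Lagrange equations
  comes from.\<close>

lemma Caputo_conv:
  assumes ab: "\<alpha> < 1" "\<beta> < 1" and f: "continuous_on {a..b} f" and x: "x \<in> {a..b}"
  shows "\<gamma> * left_RL_integral a (1 - \<alpha>) f x + (1 - \<gamma>) * (- right_RL_integral b (1 - \<beta>) f x)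
      = conv a b (Caputo_kernel (b - a) \<alpha> \<beta> \<gamma>) f x"
    and "combined_RL_integral a b \<beta> \<alpha> (1 - \<gamma>) f x = - conv a b (\<lambda>s. Caputo_kernel (b - a) \<alpha> \<beta> \<gamma> (- s)) f x"
proof -
  have k: "integrable lborel (power_kernel (b - a) (1 - \<alpha>))" "integrable lborel (power_kernel (b - a) (1 - \<beta>))"
    using ab x by (auto intro!: integrable_power_kernel)
  have k': "integrable lborel (\<lambda>s. power_kernel (b - a) (1 - \<alpha>) (- s))"
    "integrable lborel (\<lambda>s. power_kernel (b - a) (1 - \<beta>) (- s))"
    using integrable_lborel_reflect[OF k(1), of 0] integrable_lborel_reflect[OF k(2), of 0] by simp_all
  show "\<gamma> * left_RL_integral a (1 - \<alpha>) f x + (1 - \<gamma>) * (- right_RL_integral b (1 - \<beta>) f x)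
      = conv a b (Caputo_kernel (b - a) \<alpha> \<beta> \<gamma>) f x"
    unfolding Caputo_kernel_def[abs_def] conv_lincomb[OF k(1) k'(2) f]
    using ab by (simp add: left_RL_conv[OF _ f x] right_RL_conv[OF _ f x] algebra_simps)
  show "combined_RL_integral a b \<beta> \<alpha> (1 - \<gamma>) f x = - conv a b (\<lambda>s. Caputo_kernel (b - a) \<alpha> \<beta> \<gamma> (- s)) f x"
    unfolding Caputo_kernel_def[abs_def] combined_RL_integral_def minus_minus conv_lincomb[OF k'(1) k(2) f]
    using ab by (simp add: left_RL_conv[OF _ f x] right_RL_conv[OF _ f x] algebra_simps)
qed

section \<open>Variations of a curve\<close>

text \<open>The splitting of \<open>r\<close> is demanded only off a null set, since for a varied
  absolutely continuous function the derivative is known to be additive only almost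
  everywhere.\<close>

lemma absolutely_integrable_weighted_add:
  fixes w p q r :: "real \<Rightarrow> real"
  assumes p: "(\<lambda>t. w t * p t) absolutely_integrable_on S" and q: "(\<lambda>t. w t * q t) absolutely_integrable_on S"
    and N: "negligible N" and r: "\<And>t. t \<in> S - N \<Longrightarrow> r t = p t + c * q t"
  shows "(\<lambda>t. w t * r t) absolutely_integrable_on S"
    and "(LINT t:S|lebesgue. w t * r t) = (LINT t:S|lebesgue. w t * p t) + c * (LINT t:S|lebesgue. w t * q t)"
proof -
  have cq: "(\<lambda>t. c * (w t * q t)) absolutely_integrable_on S" using q by simp
  have sum: "(\<lambda>t. w t * p t + c * (w t * q t)) absolutely_integrable_on S" using p cq by (rule set_integral_add)
  have eq: "w t * r t = w t * p t + c * (w t * q t)" if "t \<in> S - N" for t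
    using r[OF that] by (simp add: algebra_simps)
  show *: "(\<lambda>t. w t * r t) absolutely_integrable_on S"
    by (rule absolutely_integrable_spike[OF sum N eq])
  have "(LINT t:S|lebesgue. w t * r t) = integral S (\<lambda>t. w t * r t)"
    using * by (rule set_lebesgue_integral_eq_integral(2))
  also have "\<dots> = integral S (\<lambda>t. w t * p t + c * (w t * q t))"
    using eq by (rule integral_spike[OF N, symmetric])
  also have "\<dots> = (LINT t:S|lebesgue. w t * p t + c * (w t * q t))"
    using sum by (rule set_lebesgue_integral_eq_integral(2)[symmetric])
  also have "\<dots> = (LINT t:S|lebesgue. w t * p t) + (LINT t:S|lebesgue. c * (w t * q t))"
    using p cq by (rule set_integral_add)
  finally show "(LINT t:S|lebesgue. w t * r t) = (LINT t:S|lebesgue. w t * p t) + c * (LINT t:S|lebesgue. w t * q t)"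
    by simp
qed

text \<open>\<open>deriv\<close> is additive off the null set where \<open>y\<close> is not
  differentiable; on that set its values are invisible to the integrals. The derivative of
  \<open>\<eta>\<close> is two-sided to match \<open>deriv\<close> at the end points as
  well.\<close>

lemma combined_Caputo_add_C1:
  assumes ord: "\<alpha> < 1" "\<beta> < 1"
    and y: "absolutely_continuous_on_Icc a b y" and ex: "combined_Caputo_exists a b \<alpha> \<beta> \<gamma> y x"
    and \<eta>: "\<And>t. t \<in> {a..b} \<Longrightarrow> (\<eta> has_real_derivative h t) (at t)" and h: "continuous_on {a..b} h"
    and x: "x \<in> {a..b}"
  shows "combined_Caputo_exists a b \<alpha> \<beta> \<gamma> (\<lambda>t. y t + c * \<eta> t) x"
    and "combined_Caputo_deriv a b \<alpha> \<beta> \<gamma> (\<lambda>t. y t + c * \<eta> t) x =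
      combined_Caputo_deriv a b \<alpha> \<beta> \<gamma> y x + c * conv a b (Caputo_kernel (b - a) \<alpha> \<beta> \<gamma>) h x"
proof -
  define N where "N = {t\<in>{a..b}. \<not> y differentiable (at t)}"
  have N: "negligible N" unfolding N_def by (rule AC_differentiable_almost_everywhere[OF y])
  have der: "deriv (\<lambda>t. y t + c * \<eta> t) t = deriv y t + c * h t" if "t \<in> {a..b} - N" for t
  proof (rule DERIV_imp_deriv)
    have "y differentiable (at t)" using that by (auto simp: N_def)
    then obtain D where "(y has_real_derivative D) (at t)" unfolding real_differentiable_def by blast
    then have "(y has_real_derivative deriv y t) (at t)" using DERIV_imp_deriv by blast
    then show "((\<lambda>t. y t + c * \<eta> t) has_real_derivative deriv y t + c * h t) (at t)"
      using \<eta>[of t] that by (intro DERIV_add DERIV_cmult) auto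
  qed
  have l: "left_RL_integral_exists a (1 - \<alpha>) (deriv (\<lambda>t. y t + c * \<eta> t)) x"
      "left_RL_integral a (1 - \<alpha>) (deriv (\<lambda>t. y t + c * \<eta> t)) x =
       left_RL_integral a (1 - \<alpha>) (deriv y) x + c * left_RL_integral a (1 - \<alpha>) h x" if "\<gamma> \<noteq> 0"
  proof -
    have 1: "(\<lambda>t. (x - t) powr (1 - \<alpha> - 1) * deriv y t) absolutely_integrable_on {a..x}"
      using ex that by (simp add: combined_Caputo_exists_def left_RL_integral_exists_def)
    have 2: "(\<lambda>t. (x - t) powr (1 - \<alpha> - 1) * h t) absolutely_integrable_on {a..x}"
      using left_RL_conv(1)[OF _ h x, of "1 - \<alpha>"] ord by (simp add: left_RL_integral_exists_def)
    have 3: "deriv (\<lambda>t. y t + c * \<eta> t) t = deriv y t + c * h t" if "t \<in> {a..x} - N" for t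
      using that x by (intro der) auto
    show "left_RL_integral_exists a (1 - \<alpha>) (deriv (\<lambda>t. y t + c * \<eta> t)) x"
      unfolding left_RL_integral_exists_def by (rule absolutely_integrable_weighted_add(1)[OF 1 2 N 3])
    have "(LINT t:{a..x}|lebesgue. (x - t) powr (1 - \<alpha> - 1) * deriv (\<lambda>t. y t + c * \<eta> t) t) =
      (LINT t:{a..x}|lebesgue. (x - t) powr (1 - \<alpha> - 1) * deriv y t) + c * (LINT t:{a..x}|lebesgue. (x - t) powr (1 - \<alpha> - 1) * h t)"
      by (rule absolutely_integrable_weighted_add(2)[OF 1 2 N 3])
    then show "left_RL_integral a (1 - \<alpha>) (deriv (\<lambda>t. y t + c * \<eta> t)) x =
       left_RL_integral a (1 - \<alpha>) (deriv y) x + c * left_RL_integral a (1 - \<alpha>) h x"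
      unfolding left_RL_integral_def by (simp add: distrib_left)
  qed
  have r: "right_RL_integral_exists b (1 - \<beta>) (deriv (\<lambda>t. y t + c * \<eta> t)) x"
      "right_RL_integral b (1 - \<beta>) (deriv (\<lambda>t. y t + c * \<eta> t)) x =
       right_RL_integral b (1 - \<beta>) (deriv y) x + c * right_RL_integral b (1 - \<beta>) h x" if "1 - \<gamma> \<noteq> 0"
  proof -
    have 1: "(\<lambda>t. (t - x) powr (1 - \<beta> - 1) * deriv y t) absolutely_integrable_on {x..b}"
      using ex that by (simp add: combined_Caputo_exists_def right_RL_integral_exists_def)
    have 2: "(\<lambda>t. (t - x) powr (1 - \<beta> - 1) * h t) absolutely_integrable_on {x..b}"
      using right_RL_conv(1)[OF _ h x, of "1 - \<beta>"] ord by (simp add: right_RL_integral_exists_def)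
    have 3: "deriv (\<lambda>t. y t + c * \<eta> t) t = deriv y t + c * h t" if "t \<in> {x..b} - N" for t
      using that x by (intro der) auto
    show "right_RL_integral_exists b (1 - \<beta>) (deriv (\<lambda>t. y t + c * \<eta> t)) x"
      unfolding right_RL_integral_exists_def by (rule absolutely_integrable_weighted_add(1)[OF 1 2 N 3])
    have "(LINT t:{x..b}|lebesgue. (t - x) powr (1 - \<beta> - 1) * deriv (\<lambda>t. y t + c * \<eta> t) t) =
      (LINT t:{x..b}|lebesgue. (t - x) powr (1 - \<beta> - 1) * deriv y t) + c * (LINT t:{x..b}|lebesgue. (t - x) powr (1 - \<beta> - 1) * h t)"
      by (rule absolutely_integrable_weighted_add(2)[OF 1 2 N 3])
    then show "right_RL_integral b (1 - \<beta>) (deriv (\<lambda>t. y t + c * \<eta> t)) x =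
       right_RL_integral b (1 - \<beta>) (deriv y) x + c * right_RL_integral b (1 - \<beta>) h x"
      unfolding right_RL_integral_def by (simp add: distrib_left)
  qed
  show "combined_Caputo_exists a b \<alpha> \<beta> \<gamma> (\<lambda>t. y t + c * \<eta> t) x"
    using l(1) r(1) by (simp add: combined_Caputo_exists_def)
  \<comment> \<open>For a zero coefficient the integral itself need not exist, so additivity is
    stated for the weighted term, where it is trivial in that case.\<close>
  have "\<gamma> * left_RL_integral a (1 - \<alpha>) (deriv (\<lambda>t. y t + c * \<eta> t)) x =
      \<gamma> * (left_RL_integral a (1 - \<alpha>) (deriv y) x + c * left_RL_integral a (1 - \<alpha>) h x)"
    using l(2) by (cases "\<gamma> = 0") auto
  moreover have "(1 - \<gamma>) * right_RL_integral b (1 - \<beta>) (deriv (\<lambda>t. y t + c * \<eta> t)) x =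
      (1 - \<gamma>) * (right_RL_integral b (1 - \<beta>) (deriv y) x + c * right_RL_integral b (1 - \<beta>) h x)"
    using r(2) by (cases "1 - \<gamma> = 0") auto
  ultimately show "combined_Caputo_deriv a b \<alpha> \<beta> \<gamma> (\<lambda>t. y t + c * \<eta> t) x =
      combined_Caputo_deriv a b \<alpha> \<beta> \<gamma> y x + c * conv a b (Caputo_kernel (b - a) \<alpha> \<beta> \<gamma>) h x"
    unfolding combined_Caputo_deriv_def left_Caputo_deriv_def right_Caputo_deriv_def
      Caputo_conv(1)[OF ord h x, symmetric]
    by (simp add: algebra_simps)
qed

lemma combined_Caputo_zero: "combined_Caputo_deriv a b \<alpha> \<beta> \<gamma> (\<lambda>t. 0) x = 0"
  by (simp add: combined_Caputo_deriv_def left_Caputo_deriv_def right_Caputo_deriv_def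
      left_RL_integral_def right_RL_integral_def set_lebesgue_integral_def)

lemma combined_Caputo_C1:
  assumes ord: "\<alpha> < 1" "\<beta> < 1"
    and \<eta>: "\<And>t. t \<in> {a..b} \<Longrightarrow> (\<eta> has_real_derivative h t) (at t)" and h: "continuous_on {a..b} h"
    and x: "x \<in> {a..b}"
  shows "combined_Caputo_deriv a b \<alpha> \<beta> \<gamma> (\<lambda>t. c * \<eta> t) x = c * conv a b (Caputo_kernel (b - a) \<alpha> \<beta> \<gamma>) h x"
proof -
  have "absolutely_continuous_on_Icc a b (\<lambda>t. 0)" using AC_linear[of a b 0] by simp
  moreover have "combined_Caputo_exists a b \<alpha> \<beta> \<gamma> (\<lambda>t. 0) x"
    by (simp add: combined_Caputo_exists_def left_RL_integral_exists_def right_RL_integral_exists_def)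
  ultimately show ?thesis
    using combined_Caputo_add_C1(2)[OF ord _ _ \<eta> h x, of "\<lambda>_. 0" \<gamma> c] by (simp add: combined_Caputo_zero)
qed

lemma AC_C1:
  assumes \<eta>: "\<And>t. t \<in> {a..b} \<Longrightarrow> (\<eta> has_real_derivative h t) (at t)" and h: "continuous_on {a..b} h"
  shows "absolutely_continuous_on_Icc a b \<eta>"
proof -
  have "bounded (h ` {a..b})" using h by (intro compact_imp_bounded compact_continuous_image) auto
  then obtain M where M: "\<forall>t\<in>{a..b}. \<bar>h t\<bar> \<le> M" by (auto simp: bounded_iff)
  \<comment> \<open>The maximum keeps the constant nonnegative even if \<open>[a, b]\<close> is
    empty.\<close>
  have "(max 0 M)-lipschitz_on {a..b} \<eta>"
  proof (rule lipschitz_onI)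
    fix s t assume st: "s \<in> {a..b}" "t \<in> {a..b}"
    have "norm (\<eta> s - \<eta> t) \<le> max 0 M * norm (s - t)"
      by (rule field_differentiable_bound[of "{a..b}" \<eta> h])
        (use M st in \<open>auto intro!: DERIV_subset[OF \<eta>] intro: max.coboundedI2\<close>)
    then show "dist (\<eta> s) (\<eta> t) \<le> max 0 M * dist s t" by (simp add: dist_norm)
  qed simp
  then show ?thesis by (rule AC_lipschitz)
qed

section \<open>Variation of a single component with fixed end points\<close>

locale component_variation =
  fixes a b :: real and \<alpha> \<beta> \<gamma> :: "real^'n" and y :: "real \<Rightarrow> real^'n" and i :: 'n
    and \<eta> h :: "real \<Rightarrow> real"
  assumes ab: "a < b"
    and ord: "\<alpha> $ i < 1" "\<beta> $ i < 1"
    and y: "y \<in> curve_space a b \<alpha> \<beta> \<gamma>"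
    and deriv_\<eta>: "\<And>t. t \<in> {a..b} \<Longrightarrow> (\<eta> has_real_derivative h t) (at t)"
    and cont_h: "continuous_on {a..b} h"
    and ends: "\<eta> a = 0" "\<eta> b = 0"
begin

text \<open>On \<open>[a, b]\<close> this is the combined Caputo derivative of
  \<open>\<eta>\<close>, written as a convolution so that its continuity is immediate.\<close>

definition C :: "real \<Rightarrow> real" where
  "C = conv a b (Caputo_kernel (b - a) (\<alpha> $ i) (\<beta> $ i) (\<gamma> $ i)) h"

definition varied :: "real \<Rightarrow> real \<Rightarrow> real^'n" where
  "varied \<epsilon> t = y t + (\<epsilon> * \<eta> t) *\<^sub>R axis i 1"

lemma cont_C: "continuous_on S C"
  unfolding C_def using ord ab by (intro continuous_on_conv integrable_Caputo_kernel cont_h) auto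

lemma varied_component: "(\<lambda>t. varied \<epsilon> t $ j) = (if j = i then (\<lambda>t. y t $ i + \<epsilon> * \<eta> t) else (\<lambda>t. y t $ j))"
  by (auto simp: varied_def axis_def fun_eq_iff)

lemma y_component:
  shows "absolutely_continuous_on_Icc a b (\<lambda>t. y t $ j)"
    and "x \<in> {a..b} \<Longrightarrow> combined_Caputo_exists a b (\<alpha> $ j) (\<beta> $ j) (\<gamma> $ j) (\<lambda>t. y t $ j) x"
    and "continuous_on {a..b} (combined_Caputo_vec a b \<alpha> \<beta> \<gamma> y)"
  using y by (auto simp: curve_space_def)

lemma Caputo_varied:
  assumes "x \<in> {a..b}"
  shows "combined_Caputo_vec a b \<alpha> \<beta> \<gamma> (varied \<epsilon>) x = combined_Caputo_vec a b \<alpha> \<beta> \<gamma> y x + (\<epsilon> * C x) *\<^sub>R axis i 1"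
  using combined_Caputo_add_C1(2)[OF ord y_component(1) y_component(2)[OF assms] deriv_\<eta> cont_h assms]
  by (simp add: vec_eq_iff combined_Caputo_vec_def varied_component axis_def C_def)

lemma varied_in_curve_space: "varied \<epsilon> \<in> curve_space a b \<alpha> \<beta> \<gamma>"
  unfolding curve_space_def mem_Collect_eq
proof (intro conjI allI ballI)
  fix j
  have "absolutely_continuous_on_Icc a b (\<lambda>t. \<epsilon> * \<eta> t)"
    by (rule AC_C1[of _ _ _ "\<lambda>t. \<epsilon> * h t"]) (auto intro!: DERIV_cmult deriv_\<eta> continuous_intros cont_h)
  then show "absolutely_continuous_on_Icc a b (\<lambda>t. varied \<epsilon> t $ j)"
    unfolding varied_component by (auto intro: AC_add y_component)
  fix x assume x: "x \<in> {a..b}"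
  show "combined_Caputo_exists a b (\<alpha> $ j) (\<beta> $ j) (\<gamma> $ j) (\<lambda>t. varied \<epsilon> t $ j) x"
    unfolding varied_component
    using y_component(2)[OF x] combined_Caputo_add_C1(1)[OF ord y_component(1) y_component(2)[OF x] deriv_\<eta> cont_h x]
    by simp
next
  have "continuous_on {a..b} (\<lambda>x. combined_Caputo_vec a b \<alpha> \<beta> \<gamma> y x + (\<epsilon> * C x) *\<^sub>R axis i 1)"
    by (intro continuous_intros y_component(3) cont_C)
  then show "continuous_on {a..b} (combined_Caputo_vec a b \<alpha> \<beta> \<gamma> (varied \<epsilon>))"
    by (rule continuous_on_eq) (simp add: Caputo_varied)
qed

lemma Caputo_variation:
  assumes "x \<in> {a..b}"
  shows "combined_Caputo_vec a b \<alpha> \<beta> \<gamma> (\<lambda>x. varied \<epsilon> x - y x) x = (\<epsilon> * C x) *\<^sub>R axis i 1"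
proof -
  have "(\<lambda>t. (varied \<epsilon> t - y t) $ j) = (if j = i then (\<lambda>t. \<epsilon> * \<eta> t) else (\<lambda>t. 0))" for j
    by (auto simp: varied_def axis_def fun_eq_iff)
  then show ?thesis
    using combined_Caputo_C1[OF ord deriv_\<eta> cont_h assms]
    by (simp add: vec_eq_iff combined_Caputo_vec_def combined_Caputo_zero axis_def C_def)
qed

text \<open>The variation and its Caputo derivative are both \<open>\<epsilon>\<close> times a
  bounded function times one fixed axis vector, so homogeneity of \<open>\<nu>\<close> bounds both
  suprema by a multiple of the modulus of \<open>\<epsilon>\<close>.\<close>

lemma norm_variation_bound:
  assumes \<nu>: "is_norm \<nu>"
  shows "\<exists>B. \<forall>\<epsilon>. norm_1_inf \<nu> a b \<alpha> \<beta> \<gamma> (\<lambda>x. varied \<epsilon> x - y x) \<le> \<bar>\<epsilon>\<bar> * B"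
proof -
  have "continuous_on {a..b} \<eta>"
    by (rule DERIV_continuous_on) (use deriv_\<eta> DERIV_subset in blast)
  then have "bounded (\<eta> ` {a..b})" by (intro compact_imp_bounded compact_continuous_image) auto
  then obtain M1 where M1: "\<forall>t\<in>{a..b}. \<bar>\<eta> t\<bar> \<le> M1" by (auto simp: bounded_iff)
  have "bounded (C ` {a..b})" using cont_C by (intro compact_imp_bounded compact_continuous_image) auto
  then obtain M2 where M2: "\<forall>t\<in>{a..b}. \<bar>C t\<bar> \<le> M2" by (auto simp: bounded_iff)
  define e where "e = \<nu> (axis i 1 :: real^'n)"
  have e: "e \<ge> 0" and sc: "\<nu> (c *\<^sub>R axis i 1) = \<bar>c\<bar> * e" for c
    using \<nu> by (auto simp: is_norm_def e_def)
  have "norm_1_inf \<nu> a b \<alpha> \<beta> \<gamma> (\<lambda>x. varied \<epsilon> x - y x) \<le> \<bar>\<epsilon>\<bar> * (M1 * e + M2 * e)" for \<epsilon>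
  proof -
    have "(SUP x\<in>{a..b}. \<nu> (varied \<epsilon> x - y x)) \<le> \<bar>\<epsilon>\<bar> * (M1 * e)"
    proof (rule cSUP_least)
      fix x assume "x \<in> {a..b}"
      then show "\<nu> (varied \<epsilon> x - y x) \<le> \<bar>\<epsilon>\<bar> * (M1 * e)"
        using M1 e by (simp add: varied_def sc abs_mult mult.assoc mult_left_mono mult_right_mono)
    qed (use ab in auto)
    moreover have "(SUP x\<in>{a..b}. \<nu> (combined_Caputo_vec a b \<alpha> \<beta> \<gamma> (\<lambda>x. varied \<epsilon> x - y x) x)) \<le> \<bar>\<epsilon>\<bar> * (M2 * e)"
    proof (rule cSUP_least)
      fix x assume "x \<in> {a..b}"
      then show "\<nu> (combined_Caputo_vec a b \<alpha> \<beta> \<gamma> (\<lambda>x. varied \<epsilon> x - y x) x) \<le> \<bar>\<epsilon>\<bar> * (M2 * e)"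
        using M2 e by (simp add: Caputo_variation sc abs_mult mult.assoc mult_left_mono mult_right_mono)
    qed (use ab in auto)
    ultimately show ?thesis unfolding norm_1_inf_def by (simp add: distrib_left)
  qed
  then show ?thesis by blast
qed

lemma jet_varied:
  assumes "x \<in> {a..b}"
  shows "jet a b \<alpha> \<beta> \<gamma> (varied \<epsilon>) x =
    (x, y x + (\<epsilon> * \<eta> x) *\<^sub>R axis i 1, combined_Caputo_vec a b \<alpha> \<beta> \<gamma> y x + (\<epsilon> * C x) *\<^sub>R axis i 1)"
  by (simp add: jet_def Caputo_varied[OF assms] varied_def)

end

section \<open>The Euler--Lagrange equations\<close>

text \<open>\<open>L\<close> is differentiable only within the slab, one-sidedly in \<open>x\<close>
  at its faces. The direction has no \<open>x\<close> component, so the line stays in the slab and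
  the derivative along it is two-sided.\<close>

lemma C1_directional_derivative:
  fixes L :: "real \<times> (real^'n) \<times> (real^'n) \<Rightarrow> real"
  assumes L': "\<And>z. z \<in> {a..b} \<times> UNIV \<Longrightarrow> (L has_derivative blinfun_apply (L' z)) (at z within {a..b} \<times> UNIV)"
    and x: "x \<in> {a..b}"
  shows "((\<lambda>s. L (x, u + (s * p) *\<^sub>R e, v + (s * q) *\<^sub>R e)) has_real_derivative
     L' (x, u + (s * p) *\<^sub>R e, v + (s * q) *\<^sub>R e) (0, p *\<^sub>R e, q *\<^sub>R e)) (at s)"
proof -
  have d: "((\<lambda>s. (x, u + (s * p) *\<^sub>R e, v + (s * q) *\<^sub>R e)) has_derivative
     (\<lambda>s. (0, (s * p) *\<^sub>R e, (s * q) *\<^sub>R e))) (at s)"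
    by (auto intro!: derivative_eq_intros)
  have "range (\<lambda>s. (x, u + (s * p) *\<^sub>R e, v + (s * q) *\<^sub>R e)) \<subseteq> {a..b} \<times> UNIV" using x by auto
  from has_derivative_in_compose2[OF L' this UNIV_I d]
  have "((\<lambda>s. L (x, u + (s * p) *\<^sub>R e, v + (s * q) *\<^sub>R e)) has_derivative
     (\<lambda>t. L' (x, u + (s * p) *\<^sub>R e, v + (s * q) *\<^sub>R e) (0, (t * p) *\<^sub>R e, (t * q) *\<^sub>R e))) (at s)" .
  moreover have "L' z (0, (t * p) *\<^sub>R e, (t * q) *\<^sub>R e) = L' z (0, p *\<^sub>R e, q *\<^sub>R e) * t" for z t
    using blinfun.scaleR_right[of "L' z" t "(0, p *\<^sub>R e, q *\<^sub>R e)"] by (simp add: mult.commute)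
  ultimately show ?thesis by (simp add: has_field_derivative_def)
qed

lemma partial_eq:
  assumes L': "\<And>z. z \<in> {a..b} \<times> UNIV \<Longrightarrow> (L has_derivative blinfun_apply (L' z)) (at z within {a..b} \<times> UNIV)"
    and x: "x \<in> {a..b}"
  shows "partial_u i L (x, u, v) = L' (x, u, v) (0, axis i 1, 0)"
    and "partial_v i L (x, u, v) = L' (x, u, v) (0, 0, axis i 1)"
  using DERIV_imp_deriv[OF C1_directional_derivative[OF L' x, of u 1 "axis i 1" v 0 0]]
    DERIV_imp_deriv[OF C1_directional_derivative[OF L' x, of u 0 "axis i 1" v 1 0]]
  by (auto simp: partial_u_def partial_v_def)

lemma continuous_imp_LINT_eq_integral:
  fixes f :: "real \<Rightarrow> real"
  assumes "continuous_on {a..b} f"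
  shows "(LINT x:{a..b}|lebesgue. f x) = integral {a..b} f" "(LINT x:{a..b}|lborel. f x) = integral {a..b} f"
proof -
  show "(LINT x:{a..b}|lebesgue. f x) = integral {a..b} f"
    by (intro set_lebesgue_integral_eq_integral absolutely_integrable_continuous_real assms)
  show "(LINT x:{a..b}|lborel. f x) = integral {a..b} f"
    by (intro set_borel_integral_eq_integral borel_integrable_atLeastAtMost' assms)
qed

context component_variation
begin

text \<open>The action of the varied curves is a real function of \<open>\<epsilon>\<close> with a
  local minimum at 0, and it can be differentiated under the integral sign.\<close>

lemma first_variation:
  assumes L': "\<And>z. z \<in> {a..b} \<times> UNIV \<Longrightarrow> (L has_derivative blinfun_apply (L' z)) (at z within {a..b} \<times> UNIV)"
    and cL': "continuous_on ({a..b} \<times> UNIV) L'" and \<nu>: "is_norm \<nu>"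
    and min: "local_minimizer (norm_1_inf \<nu> a b \<alpha> \<beta> \<gamma>) (admissible_curves a b \<alpha> \<beta> \<gamma> ya yb) (action a b \<alpha> \<beta> \<gamma> L) y"
  shows "integral {a..b} (\<lambda>x. partial_u i L (jet a b \<alpha> \<beta> \<gamma> y x) * \<eta> x + partial_v i L (jet a b \<alpha> \<beta> \<gamma> y x) * C x) = 0"
proof -
  define e where "e = (axis i 1 :: real^'n)"
  define Dy where "Dy = combined_Caputo_vec a b \<alpha> \<beta> \<gamma> y"
  define P where "P \<epsilon> x = (x, y x + (\<epsilon> * \<eta> x) *\<^sub>R e, Dy x + (\<epsilon> * C x) *\<^sub>R e)" for \<epsilon> x
  have cy: "continuous_on {a..b} y"
    using continuous_on_vec_lambda[of "{a..b}" "\<lambda>i t. y t $ i"] AC_imp_continuous_on[OF y_component(1)] by simp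
  have cD: "continuous_on {a..b} Dy" unfolding Dy_def by (rule y_component(3))
  have c\<eta>: "continuous_on {a..b} \<eta>"
    by (rule DERIV_continuous_on) (use deriv_\<eta> DERIV_subset in blast)
  have cP: "continuous_on (UNIV \<times> {a..b}) (\<lambda>(\<epsilon>, x). P \<epsilon> x)"
    unfolding P_def split_def
    by (intro continuous_intros continuous_on_compose2[OF cy] continuous_on_compose2[OF cD]
        continuous_on_compose2[OF c\<eta>] continuous_on_compose2[OF cont_C]) auto
  have Pmem: "P \<epsilon> x \<in> {a..b} \<times> UNIV" if "x \<in> {a..b}" for \<epsilon> x using that by (simp add: P_def)
  have cL: "continuous_on ({a..b} \<times> UNIV) L"
    by (rule has_derivative_continuous_on) (rule L')
  have cPx: "continuous_on {a..b} (P \<epsilon>)" for \<epsilon>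
    unfolding P_def by (intro continuous_intros cy cD c\<eta> cont_C)
  have cLP: "continuous_on {a..b} (\<lambda>x. L (P \<epsilon> x))" for \<epsilon>
    by (rule continuous_on_compose2[OF cL cPx]) (use Pmem in blast)
  have jet: "jet a b \<alpha> \<beta> \<gamma> (varied \<epsilon>) x = P \<epsilon> x" if "x \<in> {a..b}" for \<epsilon> x
    using jet_varied[OF that] by (simp add: P_def e_def Dy_def)
  have varied0: "varied 0 = y" by (simp add: varied_def fun_eq_iff)
  define \<phi> where "\<phi> \<epsilon> = integral {a..b} (\<lambda>x. L (P \<epsilon> x))" for \<epsilon>
  have act: "action a b \<alpha> \<beta> \<gamma> L (varied \<epsilon>) = \<phi> \<epsilon>" for \<epsilon>
  proof -
    have "action a b \<alpha> \<beta> \<gamma> L (varied \<epsilon>) = (LINT x:{a..b}|lebesgue. L (P \<epsilon> x))"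
      unfolding action_def by (rule set_lebesgue_integral_cong) (auto simp: jet)
    then show ?thesis using continuous_imp_LINT_eq_integral(1)[OF cLP] by (simp add: \<phi>_def)
  qed
  have "(\<phi> has_field_derivative integral (cbox a b) (\<lambda>x. L' (P 0 x) (0, \<eta> x *\<^sub>R e, C x *\<^sub>R e))) (at 0 within UNIV)"
    unfolding \<phi>_def cbox_interval[symmetric]
  proof (rule leibniz_rule_field_derivative[where
        fx = "\<lambda>\<epsilon> x. L' (P \<epsilon> x) (0, \<eta> x *\<^sub>R e, C x *\<^sub>R e)"])
    fix \<epsilon> x assume "x \<in> cbox a b"
    then have "x \<in> {a..b}" by simp
    from C1_directional_derivative[OF L' this]
    show "((\<lambda>\<epsilon>. L (P \<epsilon> x)) has_field_derivative L' (P \<epsilon> x) (0, \<eta> x *\<^sub>R e, C x *\<^sub>R e)) (at \<epsilon> within UNIV)"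
      by (simp add: P_def)
  next
    fix \<epsilon> show "(\<lambda>x. L (P \<epsilon> x)) integrable_on cbox a b"
      using cLP[of \<epsilon>] integrable_continuous_real by simp
  next
    \<comment> \<open>Leibniz's rule asks for joint continuity in \<open>(\<epsilon>, x)\<close>,
      which follows from continuity of the operator-valued map \<open>L'\<close>.\<close>
    have "continuous_on (UNIV \<times> {a..b}) (\<lambda>z. L' (case z of (\<epsilon>, x) \<Rightarrow> P \<epsilon> x))"
      by (rule continuous_on_compose2[OF cL' cP]) (auto simp: P_def)
    then have "continuous_on (UNIV \<times> {a..b})
      (\<lambda>z. blinfun_apply (L' (case z of (\<epsilon>, x) \<Rightarrow> P \<epsilon> x)) (0, \<eta> (snd z) *\<^sub>R e, C (snd z) *\<^sub>R e))"
      by (intro continuous_intros continuous_on_compose2[OF c\<eta>] continuous_on_compose2[OF cont_C]) auto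
    then show "continuous_on (UNIV \<times> cbox a b) (\<lambda>(\<epsilon>, x). L' (P \<epsilon> x) (0, \<eta> x *\<^sub>R e, C x *\<^sub>R e))"
      by (simp add: split_def)
  qed auto
  then have \<phi>': "(\<phi> has_real_derivative integral {a..b} (\<lambda>x. L' (P 0 x) (0, \<eta> x *\<^sub>R e, C x *\<^sub>R e))) (at 0)"
    by simp
  obtain \<delta> where \<delta>: "\<delta> > 0" and
    loc: "\<And>z. z \<in> admissible_curves a b \<alpha> \<beta> \<gamma> ya yb \<Longrightarrow> norm_1_inf \<nu> a b \<alpha> \<beta> \<gamma> (\<lambda>x. z x - y x) < \<delta> \<Longrightarrow>
      action a b \<alpha> \<beta> \<gamma> L y \<le> action a b \<alpha> \<beta> \<gamma> L z"
    and adm: "y \<in> admissible_curves a b \<alpha> \<beta> \<gamma> ya yb"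
    using min unfolding local_minimizer_def by blast
  obtain B where B: "\<And>\<epsilon>. norm_1_inf \<nu> a b \<alpha> \<beta> \<gamma> (\<lambda>x. varied \<epsilon> x - y x) \<le> \<bar>\<epsilon>\<bar> * B"
    using norm_variation_bound[OF \<nu>] by blast
  \<comment> \<open>\<open>B\<close> may be zero or negative, hence the denominator
    \<open>\<bar>B\<bar> + 1\<close>.\<close>
  have "\<phi> 0 \<le> \<phi> \<epsilon>" if "\<bar>0 - \<epsilon>\<bar> < \<delta> / (\<bar>B\<bar> + 1)" for \<epsilon>
  proof -
    have "varied \<epsilon> \<in> admissible_curves a b \<alpha> \<beta> \<gamma> ya yb"
      using adm varied_in_curve_space ends by (simp add: admissible_curves_def varied_def)
    moreover have "norm_1_inf \<nu> a b \<alpha> \<beta> \<gamma> (\<lambda>x. varied \<epsilon> x - y x) < \<delta>"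
    proof -
      have "\<bar>\<epsilon>\<bar> * B \<le> \<bar>\<epsilon>\<bar> * (\<bar>B\<bar> + 1)" by (intro mult_left_mono) auto
      also have "\<dots> < \<delta>" using that by (simp add: field_simps)
      finally show ?thesis using B[of \<epsilon>] by simp
    qed
    ultimately show ?thesis using loc act varied0 by metis
  qed
  then have zero: "integral {a..b} (\<lambda>x. L' (P 0 x) (0, \<eta> x *\<^sub>R e, C x *\<^sub>R e)) = 0"
    by (intro DERIV_local_min[OF \<phi>', of "\<delta> / (\<bar>B\<bar> + 1)"]) (use \<delta> in auto)
  have "L' (P 0 x) (0, \<eta> x *\<^sub>R e, C x *\<^sub>R e) =
      partial_u i L (jet a b \<alpha> \<beta> \<gamma> y x) * \<eta> x + partial_v i L (jet a b \<alpha> \<beta> \<gamma> y x) * C x" if "x \<in> {a..b}" for x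
  proof -
    have P0: "jet a b \<alpha> \<beta> \<gamma> y x = P 0 x" using jet[OF that, of 0] by (simp add: varied0)
    \<comment> \<open>Splitting the direction between the \<open>u\<close> and \<open>v\<close>
      arguments lets linearity bring in the two partial derivatives.\<close>
    have "(0, \<eta> x *\<^sub>R e, C x *\<^sub>R e) = \<eta> x *\<^sub>R (0, e, 0) + C x *\<^sub>R (0 :: real, 0, e)" by simp
    then have "L' (P 0 x) (0, \<eta> x *\<^sub>R e, C x *\<^sub>R e) = \<eta> x * L' (P 0 x) (0, e, 0) + C x * L' (P 0 x) (0, 0, e)"
      by (simp only: blinfun.add_right blinfun.scaleR_right real_scaleR_def)
    then show ?thesis unfolding P0 using partial_eq[OF L' that] by (simp add: P_def e_def)
  qed
  from integral_cong[of "{a..b}", OF this] zero show ?thesis by simp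
qed

end

section \<open>The du Bois-Reymond argument and the conclusion\<close>

text \<open>The test derivative \<open>h\<close> is the deviation of \<open>P\<close> from its own
  mean. The variational equation makes \<open>h\<close> orthogonal to \<open>P\<close>, hence to
  itself, so \<open>P\<close> is constant and its convolution part inherits differentiability from
  \<open>G\<close>.\<close>

lemma Euler_Lagrange_integrated:
  assumes ab: "a < b" and k: "integrable lborel k"
    and g: "continuous_on {a..b} g" and \<phi>: "continuous_on {a..b} \<phi>"
    and var: "\<And>\<eta> h. (\<And>t. t \<in> {a..b} \<Longrightarrow> (\<eta> has_real_derivative h t) (at t)) \<Longrightarrow> continuous_on {a..b} h \<Longrightarrow>
      \<eta> a = 0 \<Longrightarrow> \<eta> b = 0 \<Longrightarrow> integral {a..b} (\<lambda>x. g x * \<eta> x + \<phi> x * conv a b k h x) = 0"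
    and x: "x \<in> {a..b}"
  shows "((\<lambda>x. - conv a b (\<lambda>s. k (- s)) \<phi> x) has_real_derivative - g x) (at x within {a..b})"
proof -
  obtain G where G: "\<And>x. x \<in> {a..b} \<Longrightarrow> (G has_vector_derivative - g x) (at x within {a..b})"
    using antiderivative_continuous[OF continuous_on_minus[OF g]] by blast
  then have G': "\<And>x. x \<in> {a..b} \<Longrightarrow> (G has_real_derivative - g x) (at x within {a..b})"
    by (simp add: has_real_derivative_iff_has_vector_derivative)
  have cG: "continuous_on {a..b} G" using G' by (rule DERIV_continuous_on)
  have k': "integrable lborel (\<lambda>s. k (- s))" using integrable_lborel_reflect[OF k, of 0] by simp
  define P where "P x = G x + conv a b (\<lambda>s. k (- s)) \<phi> x" for x
  have cP: "continuous_on {a..b} P" unfolding P_def by (intro continuous_intros cG continuous_on_conv k' \<phi>)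
  \<comment> \<open>\<open>c\<close> is the mean of \<open>P\<close>, so that \<open>h\<close>
    integrates to zero and \<open>\<eta>\<close> vanishes at both end points.\<close>
  define c where "c = integral {a..b} P / (b - a)"
  \<comment> \<open>Clamping the argument extends \<open>h\<close> continuously to the line, so that
    its antiderivative has two-sided derivatives at \<open>a\<close> and \<open>b\<close>, as
    \<open>var\<close> demands.\<close>
  define h where "h t = P (min b (max a t)) - c" for t
  have ch: "continuous_on S h" for S
    unfolding h_def by (intro continuous_intros continuous_on_compose2[OF cP]) (use ab in auto)
  have hP: "h t = P t - c" if "t \<in> {a..b}" for t using that by (simp add: h_def)
  obtain H where H: "\<And>x. x \<in> {a - 1..b + 1} \<Longrightarrow> (H has_vector_derivative h x) (at x within {a - 1..b + 1})"
    using antiderivative_continuous[OF ch] by blast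
  have H': "(H has_real_derivative h x) (at x)" if "x \<in> {a..b}" for x
  proof -
    have "at x within {a - 1..b + 1} = at x" using that by (intro at_within_interior) simp
    then show ?thesis using H[of x] that
      by (simp add: has_real_derivative_iff_has_vector_derivative)
  qed
  have int_h: "(h has_integral (H b - H a)) {a..b}"
    using ab H' by (intro fundamental_theorem_of_calculus)
      (auto simp: has_real_derivative_iff_has_vector_derivative[symmetric] intro: DERIV_subset)
  have "integral {a..b} h = integral {a..b} P - integral {a..b} (\<lambda>_. c)"
    using integrable_continuous_real[OF cP] by (subst integral_diff[symmetric]) (auto intro!: integral_cong simp: hP)
  then have h0: "integral {a..b} h = 0" using ab by (simp add: c_def)
  then have Hab: "H b - H a = 0" using integral_unique[OF int_h] by simp
  define \<eta> where "\<eta> t = H t - H a" for t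
  have d\<eta>: "(\<eta> has_real_derivative h t) (at t)" if "t \<in> {a..b}" for t
    unfolding \<eta>_def using H'[OF that] by (auto intro!: derivative_eq_intros)
  have c\<eta>: "continuous_on {a..b} \<eta>"
    by (rule DERIV_continuous_on) (use d\<eta> DERIV_subset in blast)
  have 1: "integral {a..b} (\<lambda>x. g x * \<eta> x + \<phi> x * conv a b k h x) = 0"
    using Hab by (intro var[OF d\<eta> ch]) (auto simp: \<eta>_def)
  have 2: "integral {a..b} (\<lambda>x. \<phi> x * conv a b k h x) = integral {a..b} (\<lambda>x. h x * conv a b (\<lambda>s. k (- s)) \<phi> x)"
    using conv_adjoint[OF k ch \<phi>]
    by (simp add: continuous_imp_LINT_eq_integral(2) continuous_on_mult continuous_on_conv k k' \<phi> ch)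
  \<comment> \<open>Integration by parts: the boundary terms vanish with \<open>\<eta>\<close>, and
    as \<open>G\<close> has derivative \<open>- g\<close>, the integral of \<open>g * \<eta>\<close>
    equals that of \<open>h * G\<close>.\<close>
  have "((\<lambda>x. - g x * \<eta> x + h x * G x) has_integral (G b * \<eta> b - G a * \<eta> a)) {a..b}"
  proof (rule fundamental_theorem_of_calculus)
    fix x assume x: "x \<in> {a..b}"
    have "((\<lambda>x. G x * \<eta> x) has_real_derivative - g x * \<eta> x + h x * G x) (at x within {a..b})"
      using DERIV_mult[OF G'[OF x] DERIV_subset[OF d\<eta>[OF x]]] by simp
    then show "((\<lambda>x. G x * \<eta> x) has_vector_derivative - g x * \<eta> x + h x * G x) (at x within {a..b})"
      by (simp add: has_real_derivative_iff_has_vector_derivative)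
  qed (use ab in simp)
  then have 3: "integral {a..b} (\<lambda>x. - g x * \<eta> x + h x * G x) = 0"
    using Hab by (simp add: integral_unique \<eta>_def)
  note int = integrable_continuous_real
  have i: "(\<lambda>x. g x * \<eta> x) integrable_on {a..b}" "(\<lambda>x. h x * G x) integrable_on {a..b}"
    "(\<lambda>x. \<phi> x * conv a b k h x) integrable_on {a..b}" "(\<lambda>x. h x * conv a b (\<lambda>s. k (- s)) \<phi> x) integrable_on {a..b}"
    by (intro int continuous_intros g c\<eta> ch cG \<phi> continuous_on_conv k k')+
  have "integral {a..b} (\<lambda>x. h x * P x) = integral {a..b} (\<lambda>x. h x * G x) + integral {a..b} (\<lambda>x. h x * conv a b (\<lambda>s. k (- s)) \<phi> x)"
    using i by (simp add: P_def distrib_left integral_add)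
  also have "integral {a..b} (\<lambda>x. h x * G x) = integral {a..b} (\<lambda>x. g x * \<eta> x)"
    using 3 integral_add[OF integrable_neg[OF i(1)] i(2)] by simp
  also have "integral {a..b} (\<lambda>x. g x * \<eta> x) + integral {a..b} (\<lambda>x. h x * conv a b (\<lambda>s. k (- s)) \<phi> x) = 0"
    using 1 integral_add[OF i(1) i(3)] 2 by simp
  finally have hP0: "integral {a..b} (\<lambda>x. h x * P x) = 0" .
  \<comment> \<open>As \<open>h\<close> is \<open>P - c\<close> and has mean zero, its square
    integrates to zero; continuity then forces \<open>h\<close> to vanish on
    \<open>[a, b]\<close>.\<close>
  have "integral {a..b} (\<lambda>x. h x * h x) = integral {a..b} (\<lambda>x. h x * P x - c * h x)"
    by (intro integral_cong) (simp add: hP algebra_simps)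
  also have "\<dots> = integral {a..b} (\<lambda>x. h x * P x) - integral {a..b} (\<lambda>x. c * h x)"
    by (intro integral_diff int continuous_intros ch cP)
  also have "\<dots> = 0" using hP0 h0 by simp
  finally have "\<forall>x\<in>{a..b}. h x * h x = 0"
    using integral_eq_0_iff[OF continuous_on_mult[OF ch ch] ab] by simp
  then have eq: "- conv a b (\<lambda>s. k (- s)) \<phi> x = G x - c" if "x \<in> {a..b}" for x
    using hP[OF that] that by (auto simp: P_def)
  have "((\<lambda>x. G x - c) has_real_derivative - g x) (at x within {a..b})"
    using DERIV_diff[OF G'[OF x] DERIV_const[of c]] by simp
  then show ?thesis
    unfolding has_field_derivative_def by (rule has_derivative_transform[OF x, rotated]) (rule eq)
qed

text \<open>Minimality controls only the combination of the two fractional integrals, so the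
  equation is derived for the derivative of that combination. Where its terms are differentiable
  separately, uniqueness of the derivative turns it into the equation for
  \<open>combined_RL_deriv\<close>.\<close>

theorem theorem4p6:
  fixes a b :: real
    and \<alpha> \<beta> \<gamma> ya yb :: "real^'n"
    and \<nu> :: "real^'n \<Rightarrow> real"
    and L :: "real \<times> (real^'n) \<times> (real^'n) \<Rightarrow> real"
    and y :: "real \<Rightarrow> real^'n"
  assumes "a < b"
    and "\<forall>i. 0 < \<alpha> $ i \<and> \<alpha> $ i < 1"
    and "\<forall>i. 0 < \<beta> $ i \<and> \<beta> $ i < 1"
    and "\<forall>i. 0 \<le> \<gamma> $ i \<and> \<gamma> $ i \<le> 1"
    and "is_norm \<nu>"
    and "C1_on ({a..b} \<times> UNIV) L"
    and "local_minimizer (norm_1_inf \<nu> a b \<alpha> \<beta> \<gamma>) (admissible_curves a b \<alpha> \<beta> \<gamma> ya yb)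
           (action a b \<alpha> \<beta> \<gamma> L) y"
  shows "\<forall>i. \<forall>x\<in>{a..b}.
     (combined_RL_integral a b (\<beta> $ i) (\<alpha> $ i) (1 - \<gamma> $ i)
          (\<lambda>t. partial_v i L (jet a b \<alpha> \<beta> \<gamma> y t))
        has_real_derivative - partial_u i L (jet a b \<alpha> \<beta> \<gamma> y x)) (at x within {a..b}) \<and>
     (combined_RL_exists a b (\<beta> $ i) (\<alpha> $ i) (1 - \<gamma> $ i)
          (\<lambda>t. partial_v i L (jet a b \<alpha> \<beta> \<gamma> y t)) x \<longrightarrow>
        partial_u i L (jet a b \<alpha> \<beta> \<gamma> y x) +
        combined_RL_deriv a b (\<beta> $ i) (\<alpha> $ i) (1 - \<gamma> $ i)
          (\<lambda>t. partial_v i L (jet a b \<alpha> \<beta> \<gamma> y t)) x = 0)"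
proof (intro allI ballI)
  fix i x assume x: "x \<in> {a..b}"
  let ?J = "jet a b \<alpha> \<beta> \<gamma> y"
  let ?g = "\<lambda>t. partial_u i L (?J t)" and ?\<phi> = "\<lambda>t. partial_v i L (?J t)"
  let ?k = "Caputo_kernel (b - a) (\<alpha> $ i) (\<beta> $ i) (\<gamma> $ i)"
  obtain L' where L': "\<And>z. z \<in> {a..b} \<times> UNIV \<Longrightarrow> (L has_derivative blinfun_apply (L' z)) (at z within {a..b} \<times> UNIV)"
    and cL': "continuous_on ({a..b} \<times> UNIV) L'"
    using assms(6) unfolding C1_on_def by blast
  have y: "y \<in> curve_space a b \<alpha> \<beta> \<gamma>"
    using assms(7) by (simp add: local_minimizer_def admissible_curves_def)
  have "continuous_on {a..b} (\<lambda>t. y t $ j)" for j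
    using y by (intro AC_imp_continuous_on) (simp add: curve_space_def)
  then have "continuous_on {a..b} y" using continuous_on_vec_lambda[of "{a..b}" "\<lambda>i t. y t $ i"] by simp
  then have "continuous_on {a..b} ?J"
    using y unfolding jet_def by (intro continuous_intros) (auto simp: curve_space_def)
  then have cJ: "continuous_on {a..b} (\<lambda>t. L' (?J t))"
    by (rule continuous_on_compose2[OF cL']) (auto simp: jet_def)
  have g: "continuous_on {a..b} ?g"
    by (rule continuous_on_eq[of _ "\<lambda>t. L' (?J t) (0, axis i 1, 0)"])
      (intro continuous_intros cJ, simp add: jet_def partial_eq[OF L'])
  have \<phi>: "continuous_on {a..b} ?\<phi>"
    by (rule continuous_on_eq[of _ "\<lambda>t. L' (?J t) (0, 0, axis i 1)"])
      (intro continuous_intros cJ, simp add: jet_def partial_eq[OF L'])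
  have ord: "\<alpha> $ i < 1" "\<beta> $ i < 1" using assms(2,3) by auto
  have k: "integrable lborel ?k" using ord assms(1) by (intro integrable_Caputo_kernel) auto
  have "((\<lambda>x. - conv a b (\<lambda>s. ?k (- s)) ?\<phi> x) has_real_derivative - ?g x) (at x within {a..b})"
  proof (rule Euler_Lagrange_integrated[OF assms(1) k g \<phi> _ x])
    fix \<eta> h :: "real \<Rightarrow> real"
    assume var: "\<And>t. t \<in> {a..b} \<Longrightarrow> (\<eta> has_real_derivative h t) (at t)" "continuous_on {a..b} h" "\<eta> a = 0" "\<eta> b = 0"
    \<comment> \<open>Each test function gives an instance of the locale, whose first variation is
      the required identity.\<close>
    interpret component_variation a b \<alpha> \<beta> \<gamma> y i \<eta> h
      by (rule component_variation.intro[OF assms(1) ord y var])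
    show "integral {a..b} (\<lambda>x. ?g x * \<eta> x + ?\<phi> x * conv a b ?k h x) = 0"
      using first_variation[OF L' cL' assms(5,7)] by (simp add: C_def)
  qed
  then have R: "(combined_RL_integral a b (\<beta> $ i) (\<alpha> $ i) (1 - \<gamma> $ i) ?\<phi> has_real_derivative - ?g x) (at x within {a..b})"
    unfolding has_field_derivative_def
    by (rule has_derivative_transform[OF x, rotated]) (rule Caputo_conv(2)[OF ord \<phi>])
  moreover have "?g x + combined_RL_deriv a b (\<beta> $ i) (\<alpha> $ i) (1 - \<gamma> $ i) ?\<phi> x = 0"
    if "combined_RL_exists a b (\<beta> $ i) (\<alpha> $ i) (1 - \<gamma> $ i) ?\<phi> x"
  proof -
    \<comment> \<open>As \<open>a < b\<close>, no point of \<open>[a, b]\<close> is isolated, so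
      derivatives within it are unique, also at the end points.\<close>
    have "at x within {a..b} \<noteq> bot" using x assms(1) by (simp add: trivial_limit_within islimpt_Icc)
    from has_field_derivative_unique[OF R combined_RL_integral_has_derivative[OF that] this]
    show ?thesis by simp
  qed
  ultimately show "(combined_RL_integral a b (\<beta> $ i) (\<alpha> $ i) (1 - \<gamma> $ i) ?\<phi> has_real_derivative - ?g x) (at x within {a..b}) \<and>
     (combined_RL_exists a b (\<beta> $ i) (\<alpha> $ i) (1 - \<gamma> $ i) ?\<phi> x \<longrightarrow>
        ?g x + combined_RL_deriv a b (\<beta> $ i) (\<alpha> $ i) (1 - \<gamma> $ i) ?\<phi> x = 0)"
    by blast
qed

end
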